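(* Let $\mathcal{A}$ be a Banach algebra with a bounded approximate identity and let $\sigma\in Hom(\mathcal{A})$. Suppose that $\mathcal{A}$ is $\sigma$-amenable. Then: (i) There is a bounded linear map $\theta:(\mathcal{A}\widehat{\otimes}\mathcal{A})^*\to\mathcal{A}^*$ such that $\theta\pi^*=\sigma^*$, and $\theta(\sigma(a)\cdot f)=a\cdot\theta(f)$ and $\theta(f\cdot\sigma(a))=\theta(f)\cdot a$ for all $a\in\mathcal{A}$, $f\in(\mathcal{A}\widehat{\otimes}\mathcal{A})^*$. (ii) There is a $\sigma$-$\mathcal{A}$-bimodule homomorphism $\gamma:\mathcal{A}^{**}\to(\mathcal{A}\widehat{\otimes}\mathcal{A})^{**}$ such that $\pi^{**}\gamma=\sigma^{**}$.
   Context: $Hom(\mathcal{A})$ is the set of all continuous algebra homomorphisms $\mathcal{A}\to\mathcal{A}$. The projective tensor product $\mathcal{A}\widehat{\otimes}\mathcal{A}$ is a Banach $\mathcal{A}$-bimodule via $a\cdot(b\otimes c)=ab\otimes c$ and $(b\otimes c)\cdot a=b\otimes ca$. The diagonal operator is $\pi:\mathcal{A}\widehat{\otimes}\mathcal{A}\to\mathcal{A}$, $\pi(a\otimes b)=ab$. For a Banach $\mathcal{A}$-bimodule $X$, the dual $X^*$ is a Banach $\mathcal{A}$-bimodule via $\langle a\cdot\lambda,x\rangle=\langle\lambda,x\cdot a\rangle$ and $\langle\lambda\cdot a,x\rangle=\langle\lambda,a\cdot x\rangle$; biduals are bimodules by iterating this. For Banach $\mathcal{A}$-bimodules $X,Y$,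 a bounded linear map $T:X\to Y$ is a $\sigma$-$\mathcal{A}$-bimodule homomorphism if $T(a\cdot x)=\sigma(a)\cdot T(x)$ and $T(x\cdot a)=T(x)\cdot\sigma(a)$ for all $a\in\mathcal{A}$, $x\in X$. For a Banach $\mathcal{A}$-bimodule $X$, a bounded linear map $D:\mathcal{A}\to X$ is a $\sigma$-derivation if $D(ab)=\sigma(a)\cdot D(b)+D(a)\cdot\sigma(b)$ for all $a,b\in\mathcal{A}$; it is $\sigma$-inner if there is $x\in X$ with $D(a)=\sigma(a)\cdot x-x\cdot\sigma(a)$ for all $a\in\mathcal{A}$. $\mathcal{A}$ is $\sigma$-amenable if for every Banach $\mathcal{A}$-bimodule $X$, every $\sigma$-derivation $D:\mathcal{A}\to X^*$ is $\sigma$-inner. *)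

theory Defs
  imports "HOL-Analysis.Analysis" "HOL-Algebra.Module" "HOL-Library.Poly_Mapping"
begin

subsection \<open>Complex Banach algebras\<close>

text \<open>
  Banach algebras are complex and need not have a unit.  The class real_normed_algebra
  contains the submultiplicativity of the norm, the class banach completeness.
\<close>

class complex_banach_algebra = real_normed_algebra + banach +
  fixes scaleC :: "complex \<Rightarrow> 'a \<Rightarrow> 'a"
  assumes scaleC_add_right: "scaleC c (x + y) = scaleC c x + scaleC c y"
    and scaleC_add_left: "scaleC (c + d) x = scaleC c x + scaleC d x"
    and scaleC_scaleC: "scaleC c (scaleC d x) = scaleC (c * d) x"
    and scaleC_of_real: "scaleC (complex_of_real r) x = scaleR r x"
    and mult_scaleC_left: "scaleC c x * y = scaleC c (x * y)"
    and mult_scaleC_right: "x * scaleC c y = scaleC c (x * y)"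
    and norm_scaleC: "norm (scaleC c x) = cmod c * norm x"

definition alg_hom :: "('a::complex_banach_algebra \<Rightarrow> 'a) \<Rightarrow> bool" where
  "alg_hom \<sigma> \<longleftrightarrow>
     (\<forall>a b. \<sigma> (a + b) = \<sigma> a + \<sigma> b) \<and>
     (\<forall>c a. \<sigma> (scaleC c a) = scaleC c (\<sigma> a)) \<and>
     (\<forall>a b. \<sigma> (a * b) = \<sigma> a * \<sigma> b) \<and>
     continuous_on UNIV \<sigma>"

text \<open>
  Nets are rendered by filters, as everywhere in the library; a bounded net
  corresponds to a proper filter that contains a bounded set.
\<close>

definition bounded_approx_identity :: "'a::complex_banach_algebra filter \<Rightarrow> bool" where
  "bounded_approx_identity F \<longleftrightarrow>
     F \<noteq> bot \<and>
     (\<exists>K. \<forall>\<^sub>F e in F. norm e \<le> K) \<and>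
     (\<forall>a. ((\<lambda>e. a * e) \<longlongrightarrow> a) F \<and> ((\<lambda>e. e * a) \<longlongrightarrow> a) F)"


subsection \<open>Banach spaces and Banach bimodules\<close>

text \<open>
  The bimodules over a Banach algebra have varying underlying spaces, so they are structures
  with an explicit carrier, extending the modules of HOL-Algebra.  The fields mult and one
  that these modules inherit from rings have no meaning here.
\<close>

definition complex_ring :: "complex ring" where
  "complex_ring = \<lparr>carrier = UNIV, mult = (*), one = 1, zero = 0, add = (+)\<rparr>"

record 'x nspace = "(complex, 'x) module" +
  vnorm :: "'x \<Rightarrow> real"

record ('a, 'x) bimodule = "'x nspace" +
  lact :: "'a \<Rightarrow> 'x \<Rightarrow> 'x"
  ract :: "'x \<Rightarrow> 'a \<Rightarrow> 'x"

definition normed_space :: "('x, 'm) nspace_scheme \<Rightarrow> bool" where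
  "normed_space X \<longleftrightarrow>
     Module.module complex_ring X \<and>
     (\<forall>x\<in>carrier X. 0 \<le> vnorm X x \<and> (vnorm X x = 0 \<longleftrightarrow> x = \<zero>\<^bsub>X\<^esub>)) \<and>
     (\<forall>x\<in>carrier X. \<forall>y\<in>carrier X. vnorm X (x \<oplus>\<^bsub>X\<^esub> y) \<le> vnorm X x + vnorm X y) \<and>
     (\<forall>c. \<forall>x\<in>carrier X. vnorm X (c \<odot>\<^bsub>X\<^esub> x) = cmod c * vnorm X x)"

definition banach_space :: "('x, 'm) nspace_scheme \<Rightarrow> bool" where
  "banach_space X \<longleftrightarrow>
     normed_space X \<and> Metric_space.mcomplete (carrier X) (\<lambda>x y. vnorm X (x \<ominus>\<^bsub>X\<^esub> y))"

definition bounded_linear_map ::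
    "('x, 'm) nspace_scheme \<Rightarrow> ('y, 'n) nspace_scheme \<Rightarrow> ('x \<Rightarrow> 'y) \<Rightarrow> bool" where
  "bounded_linear_map X Y T \<longleftrightarrow>
     (\<forall>x\<in>carrier X. T x \<in> carrier Y) \<and>
     (\<forall>x\<in>carrier X. \<forall>y\<in>carrier X. T (x \<oplus>\<^bsub>X\<^esub> y) = T x \<oplus>\<^bsub>Y\<^esub> T y) \<and>
     (\<forall>c. \<forall>x\<in>carrier X. T (c \<odot>\<^bsub>X\<^esub> x) = c \<odot>\<^bsub>Y\<^esub> T x) \<and>
     (\<exists>K. \<forall>x\<in>carrier X. vnorm Y (T x) \<le> K * vnorm X x)"

definition banach_bimodule :: "('a::complex_banach_algebra, 'x) bimodule \<Rightarrow> bool" where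
  "banach_bimodule X \<longleftrightarrow>
     banach_space X \<and>
     (\<forall>a. bounded_linear_map X X (lact X a)) \<and>
     (\<forall>a. bounded_linear_map X X (\<lambda>x. ract X x a)) \<and>
     (\<forall>x\<in>carrier X. \<forall>a b.
        lact X (a + b) x = lact X a x \<oplus>\<^bsub>X\<^esub> lact X b x \<and>
        ract X x (a + b) = ract X x a \<oplus>\<^bsub>X\<^esub> ract X x b) \<and>
     (\<forall>x\<in>carrier X. \<forall>c a.
        lact X (scaleC c a) x = c \<odot>\<^bsub>X\<^esub> lact X a x \<and>
        ract X x (scaleC c a) = c \<odot>\<^bsub>X\<^esub> ract X x a) \<and>
     (\<forall>x\<in>carrier X. \<forall>a b.
        lact X (a * b) x = lact X a (lact X b x) \<and>
        ract X x (a * b) = ract X (ract X x a) b \<and>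
        lact X a (ract X x b) = ract X (lact X a x) b) \<and>
     (\<exists>K. \<forall>x\<in>carrier X. \<forall>a.
        vnorm X (lact X a x) \<le> K * norm a * vnorm X x \<and>
        vnorm X (ract X x a) \<le> K * norm a * vnorm X x)"

definition alg_bimodule :: "('a::complex_banach_algebra, 'a) bimodule" where
  "alg_bimodule =
     \<lparr>carrier = UNIV, mult = (*), one = undefined, zero = 0, add = (+), smult = scaleC,
      vnorm = norm, lact = (*), ract = (*)\<rparr>"

definition scalars :: "complex nspace" where
  "scalars =
     \<lparr>carrier = UNIV, mult = (*), one = 1, zero = 0, add = (+), smult = (*), vnorm = cmod\<rparr>"

text \<open>
  A functional on X is determined by its values on the carrier of X; it takes the default
  value of the function space extensional elsewhere.
\<close>

definition dual :: "('a, 'x) bimodule \<Rightarrow> ('a, 'x \<Rightarrow> complex) bimodule" where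
  "dual X =
     \<lparr>carrier = {f \<in> extensional (carrier X). bounded_linear_map X scalars f},
      mult = undefined, one = undefined,
      zero = (\<lambda>x\<in>carrier X. 0),
      add = (\<lambda>f g. \<lambda>x\<in>carrier X. f x + g x),
      smult = (\<lambda>c f. \<lambda>x\<in>carrier X. c * f x),
      vnorm = (\<lambda>f. SUP x\<in>{x \<in> carrier X. vnorm X x \<le> 1}. cmod (f x)),
      lact = (\<lambda>a f. \<lambda>x\<in>carrier X. f (ract X x a)),
      ract = (\<lambda>f a. \<lambda>x\<in>carrier X. f (lact X a x))\<rparr>"

text \<open>For a bounded linear map T from X to Y, this is its adjoint from the dual of Y to
  the dual of X.\<close>

definition dual_map :: "('a, 'x) bimodule \<Rightarrow> ('x \<Rightarrow> 'y) \<Rightarrow> ('y \<Rightarrow> complex) \<Rightarrow> ('x \<Rightarrow> complex)" where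
  "dual_map X T f = (\<lambda>x\<in>carrier X. f (T x))"


subsection \<open>The projective tensor product\<close>

text \<open>
  A formal sum is an element of the free complex vector space on pairs.  The algebraic tensor
  product is the quotient of that space by the span of the bilinearity relations.
\<close>

type_synonym 'a formal_sum = "('a \<times> 'a) \<Rightarrow>\<^sub>0 complex"

abbreviation pair :: "'a \<Rightarrow> 'a \<Rightarrow> 'a formal_sum" where
  "pair a b \<equiv> Poly_Mapping.single (a, b) 1"

definition fs_scale :: "complex \<Rightarrow> 'a formal_sum \<Rightarrow> 'a formal_sum" where
  "fs_scale c = Poly_Mapping.map ((*) c)"

definition bilinear_relations :: "'a::complex_banach_algebra formal_sum set" where
  "bilinear_relations =
     {pair (a + a') b - pair a b - pair a' b | a a' b. True} \<union>
     {pair a (b + b') - pair a b - pair a b' | a b b'. True} \<union>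
     {pair (scaleC c a) b - fs_scale c (pair a b) | c a b. True} \<union>
     {pair a (scaleC c b) - fs_scale c (pair a b) | c a b. True}"

definition tensor_null :: "'a::complex_banach_algebra formal_sum set" where
  "tensor_null = Modules.module.span fs_scale bilinear_relations"

text \<open>The projective norm of the algebraic tensor represented by u.\<close>

definition proj_norm :: "'a::complex_banach_algebra formal_sum \<Rightarrow> real" where
  "proj_norm u =
     Inf {(\<Sum>i<n. norm (x i) * norm (y i)) | n x y.
            u - (\<Sum>i<(n::nat). pair (x i) (y i)) \<in> tensor_null}"

text \<open>
  The projective tensor product is the completion of the algebraic tensor product:
  Cauchy sequences modulo null sequences.  As formal sums that represent the same tensor
  have distance 0 in the projective norm, the sequences are taken in the space of
  formal sums, and passing to classes performs the quotient by \<^const>\<open>tensor_null\<close> as well.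
\<close>

type_synonym 'a tensor = "(nat \<Rightarrow> 'a formal_sum) set"

definition cauchy_seqs :: "(nat \<Rightarrow> 'a::complex_banach_algebra formal_sum) set" where
  "cauchy_seqs = {s. \<forall>\<epsilon>>0. \<exists>N. \<forall>m\<ge>N. \<forall>n\<ge>N. proj_norm (s m - s n) < \<epsilon>}"

definition seq_equiv ::
    "((nat \<Rightarrow> 'a::complex_banach_algebra formal_sum) \<times> (nat \<Rightarrow> 'a formal_sum)) set" where
  "seq_equiv =
     {(s, t) \<in> cauchy_seqs \<times> cauchy_seqs. (\<lambda>n. proj_norm (s n - t n)) \<longlonglongrightarrow> 0}"

definition tclass :: "(nat \<Rightarrow> 'a::complex_banach_algebra formal_sum) \<Rightarrow> 'a tensor" where
  "tclass s = seq_equiv `` {s}"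

definition trep :: "'a tensor \<Rightarrow> nat \<Rightarrow> 'a formal_sum" where
  "trep u = (SOME s. s \<in> u)"

definition elem_tensor :: "'a::complex_banach_algebra \<Rightarrow> 'a \<Rightarrow> 'a tensor" where
  "elem_tensor a b = tclass (\<lambda>_. pair a b)"

definition fs_lact :: "'a::complex_banach_algebra \<Rightarrow> 'a formal_sum \<Rightarrow> 'a formal_sum" where
  "fs_lact a u =
     (\<Sum>(b, c)\<in>Poly_Mapping.keys u. Poly_Mapping.single (a * b, c) (Poly_Mapping.lookup u (b, c)))"

definition fs_ract :: "'a::complex_banach_algebra formal_sum \<Rightarrow> 'a \<Rightarrow> 'a formal_sum" where
  "fs_ract u a =
     (\<Sum>(b, c)\<in>Poly_Mapping.keys u. Poly_Mapping.single (b, c * a) (Poly_Mapping.lookup u (b, c)))"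

definition fs_diag :: "'a::complex_banach_algebra formal_sum \<Rightarrow> 'a" where
  "fs_diag u = (\<Sum>(b, c)\<in>Poly_Mapping.keys u. scaleC (Poly_Mapping.lookup u (b, c)) (b * c))"

definition proj_tensor :: "('a::complex_banach_algebra, 'a tensor) bimodule" where
  "proj_tensor =
     \<lparr>carrier = cauchy_seqs // seq_equiv,
      mult = undefined, one = undefined,
      zero = tclass (\<lambda>_. 0),
      add = (\<lambda>u v. tclass (\<lambda>n. trep u n + trep v n)),
      smult = (\<lambda>c u. tclass (\<lambda>n. fs_scale c (trep u n))),
      vnorm = (\<lambda>u. lim (\<lambda>n. proj_norm (trep u n))),
      lact = (\<lambda>a u. tclass (\<lambda>n. fs_lact a (trep u n))),
      ract = (\<lambda>u a. tclass (\<lambda>n. fs_ract (trep u n) a))\<rparr>"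

definition diagonal_op :: "'a::complex_banach_algebra tensor \<Rightarrow> 'a" where
  "diagonal_op u = lim (\<lambda>n. fs_diag (trep u n))"


subsection \<open>Twisted homomorphisms, derivations and amenability\<close>

definition sigma_bimodule_hom ::
    "('a::complex_banach_algebra \<Rightarrow> 'a) \<Rightarrow> ('a, 'x) bimodule \<Rightarrow> ('a, 'y) bimodule
      \<Rightarrow> ('x \<Rightarrow> 'y) \<Rightarrow> bool" where
  "sigma_bimodule_hom \<sigma> X Y T \<longleftrightarrow>
     bounded_linear_map X Y T \<and>
     (\<forall>a. \<forall>x\<in>carrier X. T (lact X a x) = lact Y (\<sigma> a) (T x) \<and>
                        T (ract X x a) = ract Y (T x) (\<sigma> a))"

definition sigma_derivation ::
    "('a::complex_banach_algebra \<Rightarrow> 'a) \<Rightarrow> ('a, 'x) bimodule \<Rightarrow> ('a \<Rightarrow> 'x) \<Rightarrow> bool" where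
  "sigma_derivation \<sigma> X D \<longleftrightarrow>
     bounded_linear_map alg_bimodule X D \<and>
     (\<forall>a b. D (a * b) = lact X (\<sigma> a) (D b) \<oplus>\<^bsub>X\<^esub> ract X (D a) (\<sigma> b))"

definition sigma_inner ::
    "('a::complex_banach_algebra \<Rightarrow> 'a) \<Rightarrow> ('a, 'x) bimodule \<Rightarrow> ('a \<Rightarrow> 'x) \<Rightarrow> bool" where
  "sigma_inner \<sigma> X D \<longleftrightarrow>
     (\<exists>x\<in>carrier X. \<forall>a. D a = lact X (\<sigma> a) x \<ominus>\<^bsub>X\<^esub> ract X x (\<sigma> a))"

text \<open>
  A formula of HOL cannot quantify over types, so the bimodules range over all those whose
  carrier is a subset of one fixed type, which has to be large enough.  The type of sets of
  functions on \<^typ>\<open>'a tensor\<close> is: by weak-star compactness of balls of the dual,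
  a derivation into the dual of X is inner as soon as its restrictions to the closed
  submodules of X generated by countable sets are, and each such submodule has at most
  as many elements as there are sequences in the product of the algebra and the complex numbers.
  Hence the notion below is the unrestricted one.
\<close>

type_synonym 'a universe = "('a tensor \<Rightarrow> complex) set"

definition sigma_amenable :: "('a::complex_banach_algebra \<Rightarrow> 'a) \<Rightarrow> bool" where
  "sigma_amenable \<sigma> \<longleftrightarrow>
     (\<forall>X :: ('a, 'a universe) bimodule. banach_bimodule X \<longrightarrow>
        (\<forall>D. sigma_derivation \<sigma> (dual X) D \<longrightarrow> sigma_inner \<sigma> (dual X) D))"


subsection \<open>The defining formulas on elementary tensors\<close>

text \<open>
  The actions and the diagonal operator of \<^const>\<open>proj_tensor\<close> were defined through
  representatives; here they are shown to satisfy the formulas that characterise them.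
\<close>

lemma lookup_fs_scale: "Poly_Mapping.lookup (fs_scale c u) z = c * Poly_Mapping.lookup u z"
  by (auto simp: fs_scale_def Poly_Mapping.map.rep_eq when_def)

interpretation fs: Modules.module fs_scale
  by unfold_locales
     (auto simp: poly_mapping_eq_iff fun_eq_iff lookup_add lookup_fs_scale algebra_simps)

lemma fs_sum_superset:
  assumes "finite S" "Poly_Mapping.keys u \<subseteq> S" "\<And>z. g z 0 = (0::'b::comm_monoid_add)"
  shows "(\<Sum>z\<in>Poly_Mapping.keys u. g z (Poly_Mapping.lookup u z)) = (\<Sum>z\<in>S. g z (Poly_Mapping.lookup u z))"
  using assms by (intro sum.mono_neutral_left) (auto simp: in_keys_iff)

lemma fs_sum_add:
  assumes "\<And>z x y. g z (x + y) = g z x + (g z y :: 'b::cancel_comm_monoid_add)"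
  shows "(\<Sum>z\<in>Poly_Mapping.keys (u + v). g z (Poly_Mapping.lookup (u + v) z)) =
         (\<Sum>z\<in>Poly_Mapping.keys u. g z (Poly_Mapping.lookup u z)) +
         (\<Sum>z\<in>Poly_Mapping.keys v. g z (Poly_Mapping.lookup v z))"
proof -
  have 0: "\<And>z. g z 0 = 0" using assms[of _ 0 0] by simp
  let ?S = "Poly_Mapping.keys u \<union> Poly_Mapping.keys v"
  have "Poly_Mapping.keys (u+v) \<subseteq> ?S" by (rule Poly_Mapping.keys_add)
  then show ?thesis
    using fs_sum_superset[of ?S "u+v" g] fs_sum_superset[of ?S u g] fs_sum_superset[of ?S v g] 0
    by (simp add: lookup_add assms sum.distrib)
qed

lemma keys_fs_scale: "Poly_Mapping.keys (fs_scale c u) \<subseteq> Poly_Mapping.keys u"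
  by (auto simp: fs_scale_def in_keys_iff Poly_Mapping.map.rep_eq when_def split: if_splits)

lemma fs_sum_scale:
  assumes "\<And>z x. g z (c * x) = h (g z x)" "\<And>x y. h (x + y) = h x + (h y :: 'b::cancel_comm_monoid_add)"
     "\<And>z. g z 0 = 0"
  shows "(\<Sum>z\<in>Poly_Mapping.keys (fs_scale c u). g z (Poly_Mapping.lookup (fs_scale c u) z)) =
         h (\<Sum>z\<in>Poly_Mapping.keys u. g z (Poly_Mapping.lookup u z))"
proof -
  have 0: "h 0 = 0" using assms(2)[of 0 0] by simp
  have *: "(\<Sum>z\<in>S. h (f z)) = h (\<Sum>z\<in>S. f z)" for f :: "_ \<Rightarrow> 'b" and S :: "('a \<times> 'a) set"
    by (induction S rule: infinite_finite_induct) (auto simp: 0 assms(2))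
  have "(\<Sum>z\<in>Poly_Mapping.keys (fs_scale c u). g z (Poly_Mapping.lookup (fs_scale c u) z)) =
     (\<Sum>z\<in>Poly_Mapping.keys u. g z (c * Poly_Mapping.lookup u z))"
    using fs_sum_superset[OF finite_keys keys_fs_scale[of c u], of g] assms(3)
    by (simp only: lookup_fs_scale)
  then show ?thesis by (simp add: assms(1) *)
qed

lemma scaleC_0 [simp]: "scaleC 0 x = (0::'a::complex_banach_algebra)"
  using scaleC_of_real[of 0 x] by simp
lemma scaleC_1 [simp]: "scaleC 1 x = (x::'a::complex_banach_algebra)"
  using scaleC_of_real[of 1 x] by simp

lemma fs_lact_add: "fs_lact a (u + v) = fs_lact a u + fs_lact a v"
  unfolding fs_lact_def split_beta prod.collapse
  by (rule fs_sum_add[of "\<lambda>z x. Poly_Mapping.single (a * fst z, snd z) x"]) (simp add: single_add)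
lemma fs_ract_add: "fs_ract (u + v) a = fs_ract u a + fs_ract v a"
  unfolding fs_ract_def split_beta prod.collapse
  by (rule fs_sum_add[of "\<lambda>z x. Poly_Mapping.single (fst z, snd z * a) x"]) (simp add: single_add)
lemma fs_diag_add: "fs_diag (u + v) = fs_diag u + fs_diag v"
  unfolding fs_diag_def split_beta prod.collapse
  by (rule fs_sum_add[of "\<lambda>z x. scaleC x (fst z * snd z)"]) (simp add: scaleC_add_left)

lemma fs_scale_single: "fs_scale c (Poly_Mapping.single z x) = Poly_Mapping.single z (c * x)"
  by (simp add: poly_mapping_eq_iff fun_eq_iff lookup_fs_scale lookup_single when_def)
lemma fs_scale_add: "fs_scale c (u + v) = fs_scale c u + fs_scale c v"
  by (rule fs.scale_right_distrib)

lemma fs_lact_scale: "fs_lact a (fs_scale c u) = fs_scale c (fs_lact a u)"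
  unfolding fs_lact_def split_beta prod.collapse
  by (rule fs_sum_scale[of "\<lambda>z x. Poly_Mapping.single (a * fst z, snd z) x"]) (simp_all add: fs_scale_single fs_scale_add)
lemma fs_ract_scale: "fs_ract (fs_scale c u) a = fs_scale c (fs_ract u a)"
  unfolding fs_ract_def split_beta prod.collapse
  by (rule fs_sum_scale[of "\<lambda>z x. Poly_Mapping.single (fst z, snd z * a) x"]) (simp_all add: fs_scale_single fs_scale_add)
lemma fs_diag_scale: "fs_diag (fs_scale c u) = scaleC c (fs_diag u)"
  unfolding fs_diag_def split_beta prod.collapse
  by (rule fs_sum_scale[of "\<lambda>z x. scaleC x (fst z * snd z)"]) (simp_all add: scaleC_scaleC scaleC_add_right)

lemma fs_pair [simp]: "fs_lact a (pair b c) = pair (a * b) c" "fs_ract (pair b c) a = pair b (c * a)"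
   "fs_diag (pair b c) = b * c"
  by (simp_all add: fs_lact_def fs_ract_def fs_diag_def)

lemma additive_simps:
  fixes h :: "'a::ab_group_add \<Rightarrow> 'b::ab_group_add" assumes "\<And>u v. h (u + v) = h u + h v"
  shows "h 0 = 0" "h (u - v) = h u - h v" "h (sum f S) = (\<Sum>i\<in>S. h (f i))"
proof -
  interpret additive h by unfold_locales (rule assms)
  show "h 0 = 0" "h (u - v) = h u - h v" "h (sum f S) = (\<Sum>i\<in>S. h (f i))"
    by (rule zero diff sum)+
qed
lemmas fs_lact_simps = additive_simps[where h = "fs_lact _", OF fs_lact_add]
lemmas fs_ract_simps = additive_simps[where h = "\<lambda>u. fs_ract u _", OF fs_ract_add]
lemmas fs_diag_simps = additive_simps[where h = fs_diag, OF fs_diag_add]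

lemma null_subspace: "fs.subspace tensor_null" unfolding tensor_null_def by (rule fs.subspace_span)

lemma null_base: "r \<in> bilinear_relations \<Longrightarrow> r \<in> tensor_null"
  unfolding tensor_null_def by (rule fs.span_base)

lemma fs_lact_null: "u \<in> tensor_null \<Longrightarrow> fs_lact a u \<in> tensor_null"
  unfolding tensor_null_def
proof (induction rule: fs.span_induct_alt)
  case base then show ?case by (simp add: fs_lact_simps fs.span_zero)
next
  case (step c x y)
  have "fs_lact a x \<in> bilinear_relations"
    using step(1) unfolding bilinear_relations_def
    by (auto simp: fs_lact_simps fs_lact_scale distrib_left mult_scaleC_right) blast+
  then show ?case using step
    by (simp add: fs_lact_add fs_lact_scale fs.span_add fs.span_scale fs.span_base)
qed
lemma fs_ract_null: "u \<in> tensor_null \<Longrightarrow> fs_ract u a \<in> tensor_null"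
  unfolding tensor_null_def
proof (induction rule: fs.span_induct_alt)
  case base then show ?case by (simp add: fs_ract_simps fs.span_zero)
next
  case (step c x y)
  have "fs_ract x a \<in> bilinear_relations"
    using step(1) unfolding bilinear_relations_def
    by (auto simp: fs_ract_simps fs_ract_scale distrib_right mult_scaleC_left) blast+
  then show ?case using step
    by (simp add: fs_ract_add fs_ract_scale fs.span_add fs.span_scale fs.span_base)
qed
lemma fs_diag_null: "u \<in> tensor_null \<Longrightarrow> fs_diag u = 0"
  unfolding tensor_null_def
proof (induction rule: fs.span_induct_alt)
  case base then show ?case by (simp add: fs_diag_simps)
next
  case (step c x y)
  have "scaleC c (0::'a) = 0" for c using norm_scaleC[of c "0::'a"] by simp
  moreover have "fs_diag x = 0" 
    using step(1) unfolding bilinear_relations_def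
    by (auto simp: fs_diag_simps fs_diag_scale distrib_right distrib_left mult_scaleC_left mult_scaleC_right)
  ultimately show ?case using step by (simp add: fs_diag_add fs_diag_scale)
qed

definition rep_cost :: "'a::complex_banach_algebra formal_sum \<Rightarrow> real \<Rightarrow> bool" where
  "rep_cost u r \<longleftrightarrow> (\<exists>n x y. r = (\<Sum>i<n. norm (x i) * norm (y i)) \<and> u - (\<Sum>i<(n::nat). pair (x i) (y i)) \<in> tensor_null)"

lemma proj_norm_cost: "proj_norm u = Inf {r. rep_cost u r}"
  unfolding proj_norm_def rep_cost_def by (rule arg_cong[where f = Inf]) auto

lemma rep_cost_nonneg: "rep_cost u r \<Longrightarrow> 0 \<le> r" by (auto simp: rep_cost_def intro!: sum_nonneg)
lemma rep_cost_bdd: "bdd_below {r. rep_cost u r}" by (rule bdd_belowI[of _ 0]) (auto dest: rep_cost_nonneg)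

lemma rep_cost_add: assumes "rep_cost u r" "rep_cost v s" shows "rep_cost (u + v) (r + s)"
proof -
  obtain n x y where 1: "r = (\<Sum>i<n. norm (x i) * norm (y i))" "u - (\<Sum>i<(n::nat). pair (x i) (y i)) \<in> tensor_null"
    using assms(1) unfolding rep_cost_def by blast
  obtain m x' y' where 2: "s = (\<Sum>i<m. norm (x' i) * norm (y' i))" "v - (\<Sum>i<(m::nat). pair (x' i) (y' i)) \<in> tensor_null"
    using assms(2) unfolding rep_cost_def by blast
  define X where "X i = (if i < n then x i else x' (i - n))" for i
  define Y where "Y i = (if i < n then y i else y' (i - n))" for i
  have split: "(\<Sum>i<n+m. h (X i) (Y i)) = (\<Sum>i<n. h (x i) (y i)) + (\<Sum>i<m. h (x' i) (y' i))" for h :: "_ \<Rightarrow> _ \<Rightarrow> 'z::comm_monoid_add"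
  proof -
    have "(\<Sum>i<n+m. h (X i) (Y i)) = (\<Sum>i<n. h (X i) (Y i)) + (\<Sum>i=n..<n+m. h (X i) (Y i))"
      unfolding lessThan_atLeast0 by (rule sum.atLeastLessThan_concat[symmetric]) auto
    also have "(\<Sum>i=n..<n+m. h (X i) (Y i)) = (\<Sum>i<m. h (X (i+n)) (Y (i+n)))"
      using sum.shift_bounds_nat_ivl[of "\<lambda>i. h (X i) (Y i)" 0 n m] by (simp add: lessThan_atLeast0 add.commute)
    finally show ?thesis by (simp add: X_def Y_def)
  qed
  have "u + v - (\<Sum>i<n+m. pair (X i) (Y i)) \<in> tensor_null"
    using fs.subspace_add[OF null_subspace 1(2) 2(2)] unfolding split[of pair] by (simp add: algebra_simps)
  moreover have "r + s = (\<Sum>i<n+m. norm (X i) * norm (Y i))"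
    using 1 2 by (simp add: split[of "\<lambda>a b. norm a * norm b"])
  ultimately show ?thesis unfolding rep_cost_def by blast
qed

lemma rep_cost_pair: "rep_cost (pair a b) (norm a * norm b)"
  unfolding rep_cost_def
  by (rule exI[of _ 1], rule exI[of _ "\<lambda>_. a"], rule exI[of _ "\<lambda>_. b"]) (auto simp: fs.subspace_0[OF null_subspace])

lemma rep_cost_scale: assumes "rep_cost u r" shows "rep_cost (fs_scale c u) (cmod c * r)"
proof -
  obtain n x y where 1: "r = (\<Sum>i<n. norm (x i) * norm (y i))" "u - (\<Sum>i<(n::nat). pair (x i) (y i)) \<in> tensor_null"
    using assms(1) unfolding rep_cost_def by blast
  have a: "fs_scale c u - (\<Sum>i<n. fs_scale c (pair (x i) (y i))) \<in> tensor_null"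
    using fs.subspace_scale[OF null_subspace 1(2), of c] by (simp add: fs.scale_right_diff_distrib fs.scale_sum_right)
  have "(\<Sum>i<n. pair (scaleC c (x i)) (y i) - fs_scale c (pair (x i) (y i))) \<in> tensor_null"
    by (intro fs.subspace_sum[OF null_subspace] null_base) (auto simp: bilinear_relations_def)
  from fs.subspace_diff[OF null_subspace a this]
  have "fs_scale c u - (\<Sum>i<n. pair (scaleC c (x i)) (y i)) \<in> tensor_null" by (simp add: sum_subtractf)
  moreover have "cmod c * r = (\<Sum>i<n. norm (scaleC c (x i)) * norm (y i))"
    by (simp add: 1(1) norm_scaleC sum_distrib_left mult.assoc)
  ultimately show ?thesis unfolding rep_cost_def by (intro exI[of _ n] exI[of _ "\<lambda>i. scaleC c (x i)"] exI[of _ y]) auto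
qed

lemma rep_cost_null: "u \<in> tensor_null \<Longrightarrow> rep_cost u 0"
  unfolding rep_cost_def by (rule exI[of _ 0]) auto

lemma rep_cost_ex: "\<exists>r. rep_cost u r"
proof (induction u rule: update_induct)
  case const
  then show ?case using rep_cost_null[of 0] fs.subspace_0[OF null_subspace] by (auto simp: zero_poly_mapping_def[symmetric])
next
  case (update f a b)
  obtain r where r: "rep_cost f r" using update by blast
  have "Poly_Mapping.single a b = fs_scale b (pair (fst a) (snd a))" by (simp add: fs_scale_single)
  then have "rep_cost (Poly_Mapping.single a b) (cmod b * (norm (fst a) * norm (snd a)))"
    using rep_cost_scale[OF rep_cost_pair] by metis
  from rep_cost_add[OF r this] have "\<exists>r. rep_cost (f + Poly_Mapping.single a b) r" by blast
  moreover have "Poly_Mapping.update a b f = f + Poly_Mapping.single a b"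
    using update(1) by (auto simp: poly_mapping_eq_iff fun_eq_iff lookup_update lookup_add lookup_single when_def in_keys_iff)
  ultimately show ?case by simp
qed

lemma proj_norm_le: "rep_cost u r \<Longrightarrow> proj_norm u \<le> r"
  unfolding proj_norm_cost by (rule cInf_lower[OF _ rep_cost_bdd]) simp
lemma proj_norm_ge: "(\<And>r. rep_cost u r \<Longrightarrow> x \<le> r) \<Longrightarrow> x \<le> proj_norm u"
  unfolding proj_norm_cost by (rule cInf_greatest) (use rep_cost_ex in auto)
lemma proj_norm_nonneg: "0 \<le> proj_norm u" by (rule proj_norm_ge) (rule rep_cost_nonneg)
lemma proj_norm_approx: "e > 0 \<Longrightarrow> \<exists>r. rep_cost u r \<and> r < proj_norm u + e"
  using cInf_lessD[of "{r. rep_cost u r}" "proj_norm u + e"] rep_cost_ex by (auto simp: proj_norm_cost)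

lemma proj_norm_triangle: "proj_norm (u + v) \<le> proj_norm u + proj_norm v"
proof (rule field_le_epsilon)
  fix e :: real assume "e > 0"
  then obtain r s where "rep_cost u r" "r < proj_norm u + e/2" "rep_cost v s" "s < proj_norm v + e/2"
    using proj_norm_approx[of "e/2"] by (meson half_gt_zero)
  then show "proj_norm (u + v) \<le> proj_norm u + proj_norm v + e"
    using proj_norm_le[OF rep_cost_add[of u r v s]] by linarith
qed
lemma proj_norm_null: "u \<in> tensor_null \<Longrightarrow> proj_norm u = 0"
  using proj_norm_le[OF rep_cost_null] proj_norm_nonneg[of u] by force
lemma proj_norm_0 [simp]: "proj_norm 0 = 0" by (simp add: proj_norm_null fs.subspace_0[OF null_subspace])
lemma proj_norm_uminus: "proj_norm (- u) = proj_norm u"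
proof -
  have "proj_norm (- u) \<le> proj_norm u" for u :: "'a formal_sum"
    by (rule proj_norm_ge) (use proj_norm_le rep_cost_scale[of u _ "-1"] in fastforce)
  from this[of u] this[of "-u"] show ?thesis by simp
qed
lemma proj_norm_minus_commute: "proj_norm (u - v) = proj_norm (v - u)"
  using proj_norm_uminus[of "u - v"] by simp
lemma proj_norm_tri: "proj_norm (u - w) \<le> proj_norm (u - v) + proj_norm (v - w)"
  using proj_norm_triangle[of "u - v" "v - w"] by simp

lemma fs_diag_le: "norm (fs_diag u) \<le> proj_norm u"
proof (rule proj_norm_ge)
  fix r assume "rep_cost u r"
  then obtain n x y where 1: "r = (\<Sum>i<n. norm (x i) * norm (y i))" "u - (\<Sum>i<(n::nat). pair (x i) (y i)) \<in> tensor_null"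
    unfolding rep_cost_def by blast
  have "fs_diag u = (\<Sum>i<n. x i * y i)" using fs_diag_null[OF 1(2)] by (simp add: fs_diag_simps)
  also have "norm \<dots> \<le> r" unfolding 1(1) by (rule sum_norm_le) (rule norm_mult_ineq)
  finally show "norm (fs_diag u) \<le> r" .
qed

lemma proj_norm_lact: "proj_norm (fs_lact a u) \<le> norm a * proj_norm u"
proof -
  have *: "proj_norm (fs_lact a u) \<le> norm a * r" if "rep_cost u r" for r
  proof -
    obtain n x y where 1: "r = (\<Sum>i<n. norm (x i) * norm (y i))" "u - (\<Sum>i<(n::nat). pair (x i) (y i)) \<in> tensor_null"
      using \<open>rep_cost u r\<close> unfolding rep_cost_def by blast
    have "rep_cost (fs_lact a u) (\<Sum>i<n. norm (a * x i) * norm (y i))"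
      using fs_lact_null[OF 1(2), of a] unfolding rep_cost_def
      by (intro exI[of _ n] exI[of _ "\<lambda>i. a * x i"] exI[of _ y]) (simp add: fs_lact_simps)
    from proj_norm_le[OF this] show ?thesis
      by (rule order_trans) (auto simp: 1(1) sum_distrib_left mult.assoc[symmetric] intro!: sum_mono mult_right_mono norm_mult_ineq)
  qed
  show ?thesis
  proof (cases "norm a = 0")
    case True then show ?thesis using rep_cost_ex[of u] * by force
  next
    case False
    then have "proj_norm (fs_lact a u) / norm a \<le> proj_norm u"
      by (intro proj_norm_ge) (use * in \<open>auto simp: field_simps\<close>)
    with False show ?thesis by (simp add: field_simps)
  qed
qed
lemma proj_norm_ract: "proj_norm (fs_ract u a) \<le> norm a * proj_norm u"
proof -
  have *: "proj_norm (fs_ract u a) \<le> norm a * r" if "rep_cost u r" for r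
  proof -
    obtain n x y where 1: "r = (\<Sum>i<n. norm (x i) * norm (y i))" "u - (\<Sum>i<(n::nat). pair (x i) (y i)) \<in> tensor_null"
      using \<open>rep_cost u r\<close> unfolding rep_cost_def by blast
    have "rep_cost (fs_ract u a) (\<Sum>i<n. norm (x i) * norm (y i * a))"
      using fs_ract_null[OF 1(2), of a] unfolding rep_cost_def
      by (intro exI[of _ n] exI[of _ x] exI[of _ "\<lambda>i. y i * a"]) (simp add: fs_ract_simps)
    moreover have "(\<Sum>i<n. norm (x i) * norm (y i * a)) \<le> norm a * r"
      unfolding 1(1) sum_distrib_left
    proof (rule sum_mono)
      fix i
      have "norm (x i) * norm (y i * a) \<le> norm (x i) * (norm (y i) * norm a)"
        by (intro mult_left_mono norm_mult_ineq) simp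
      then show "norm (x i) * norm (y i * a) \<le> norm a * (norm (x i) * norm (y i))" by (simp add: mult_ac)
    qed
    ultimately show ?thesis using proj_norm_le by fastforce
  qed
  show ?thesis
  proof (cases "norm a = 0")
    case True then show ?thesis using rep_cost_ex[of u] * by force
  next
    case False
    then have "proj_norm (fs_ract u a) / norm a \<le> proj_norm u"
      by (intro proj_norm_ge) (use * in \<open>auto simp: field_simps\<close>)
    with False show ?thesis by (simp add: field_simps)
  qed
qed

lemma equiv_seq_equiv: "equiv cauchy_seqs (seq_equiv :: ((nat \<Rightarrow> 'a::complex_banach_algebra formal_sum) \<times> _) set)"
proof (rule equivI)
  show "seq_equiv \<subseteq> cauchy_seqs \<times> cauchy_seqs" by (auto simp: seq_equiv_def)
  show "refl_on cauchy_seqs seq_equiv" by (auto simp: refl_on_def seq_equiv_def)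
  show "sym seq_equiv" by (rule symI) (auto simp: seq_equiv_def proj_norm_minus_commute)
  show "trans (seq_equiv :: ((nat \<Rightarrow> 'a formal_sum) \<times> _) set)"
  proof (rule transI)
    fix s t r :: "nat \<Rightarrow> 'a formal_sum" assume a: "(s, t) \<in> seq_equiv" "(t, r) \<in> seq_equiv"
    have "(\<lambda>n. proj_norm (s n - t n) + proj_norm (t n - r n)) \<longlonglongrightarrow> 0 + 0"
      using a by (intro tendsto_add) (auto simp: seq_equiv_def)
    then have *: "(\<lambda>n. proj_norm (s n - t n) + proj_norm (t n - r n)) \<longlonglongrightarrow> 0" by simp
    have "(\<lambda>n. proj_norm (s n - r n)) \<longlonglongrightarrow> 0"
      by (rule tendsto_sandwich[OF always_eventually always_eventually tendsto_const *])
         (simp_all add: proj_norm_nonneg proj_norm_tri)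
    then show "(s, r) \<in> seq_equiv" using a by (auto simp: seq_equiv_def)
  qed
qed

lemma trep_tclass:
  assumes "s \<in> cauchy_seqs"
  shows "(s, trep (tclass s)) \<in> seq_equiv"
proof -
  have "s \<in> tclass s" unfolding tclass_def using equiv_class_self[OF equiv_seq_equiv assms] .
  then have "trep (tclass s) \<in> tclass s" unfolding trep_def by (rule someI[of "\<lambda>t. t \<in> tclass s"])
  then show "(s, trep (tclass s)) \<in> seq_equiv" unfolding tclass_def by simp
qed

lemma const_cauchy: "(\<lambda>_. u) \<in> cauchy_seqs" by (simp add: cauchy_seqs_def)

lemma diagonal_op_elem: "diagonal_op (elem_tensor a b) = a * b"
proof -
  let ?t = "trep (elem_tensor a b)"
  have "(\<lambda>n. proj_norm (pair a b - ?t n)) \<longlonglongrightarrow> 0"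
    using trep_tclass[OF const_cauchy, of "pair a b"] by (simp add: elem_tensor_def seq_equiv_def)
  then have "(\<lambda>n. fs_diag (pair a b - ?t n)) \<longlonglongrightarrow> 0"
    by (rule Lim_null_comparison[rotated]) (simp add: fs_diag_le)
  then have "(\<lambda>n. a * b - (a * b - fs_diag (?t n))) \<longlonglongrightarrow> a * b - 0"
    by (intro tendsto_intros) (simp add: fs_diag_simps)
  then show ?thesis unfolding diagonal_op_def by (intro limI) simp
qed

lemma tclass_eqI:
  assumes "t \<in> cauchy_seqs" "(\<lambda>n. proj_norm (s n - t n)) \<longlonglongrightarrow> 0" "s \<in> cauchy_seqs"
  shows "tclass s = tclass t"
  unfolding tclass_def
  by (rule equiv_class_eq[OF equiv_seq_equiv]) (use assms in \<open>auto simp: seq_equiv_def\<close>)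

lemma cauchy_map:
  assumes "s \<in> cauchy_seqs" "\<And>u. proj_norm (h u) \<le> K * proj_norm u" "\<And>u v. h (u - v) = h u - h v" "0 \<le> K"
  shows "(\<lambda>n. h (s n)) \<in> cauchy_seqs"
  unfolding cauchy_seqs_def
proof safe
  fix e :: real assume "e > 0"
  then have "e / (K + 1) > 0" using assms(4) by simp
  then obtain N where N: "\<And>m n. m \<ge> N \<Longrightarrow> n \<ge> N \<Longrightarrow> proj_norm (s m - s n) < e / (K + 1)"
    using assms(1) unfolding cauchy_seqs_def by blast
  have "proj_norm (h (s m) - h (s n)) < e" if "m \<ge> N" "n \<ge> N" for m n
  proof -
    have "proj_norm (h (s m) - h (s n)) \<le> K * proj_norm (s m - s n)" using assms(2,3) by metis
    also have "\<dots> \<le> (K + 1) * proj_norm (s m - s n)" by (simp add: mult_right_mono proj_norm_nonneg)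
    also have "\<dots> < e" using N[OF that] assms(4) by (simp add: field_simps)
    finally show ?thesis .
  qed
  then show "\<exists>N. \<forall>m\<ge>N. \<forall>n\<ge>N. proj_norm (h (s m) - h (s n)) < e" by blast
qed

lemma tclass_map:
  assumes "s \<in> cauchy_seqs" "\<And>u. proj_norm (h u) \<le> K * proj_norm u" "\<And>u v. h (u - v) = h u - h v" "0 \<le> K"
  shows "tclass (\<lambda>n. h (trep (tclass s) n)) = tclass (\<lambda>n. h (s n))"
proof (rule tclass_eqI)
  have t: "trep (tclass s) \<in> cauchy_seqs" "(\<lambda>n. proj_norm (trep (tclass s) n - s n)) \<longlonglongrightarrow> 0"
    using trep_tclass[OF assms(1)] by (auto simp: seq_equiv_def proj_norm_minus_commute)
  show "(\<lambda>n. h (trep (tclass s) n)) \<in> cauchy_seqs" "(\<lambda>n. h (s n)) \<in> cauchy_seqs"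
    using cauchy_map assms t by blast+
  have *: "(\<lambda>n. K * proj_norm (trep (tclass s) n - s n)) \<longlonglongrightarrow> 0"
    using tendsto_mult_right_zero[OF t(2)] .
  show "(\<lambda>n. proj_norm (h (trep (tclass s) n) - h (s n))) \<longlonglongrightarrow> 0"
    by (rule tendsto_sandwich[OF always_eventually always_eventually tendsto_const *])
       (simp_all add: proj_norm_nonneg assms(2) assms(3)[symmetric])
qed

lemma lact_elem: "lact proj_tensor a (elem_tensor b c) = elem_tensor (a * b) c"
  using tclass_map[OF const_cauchy, of "fs_lact a" "norm a" "pair b c"]
  by (simp add: proj_tensor_def elem_tensor_def proj_norm_lact fs_lact_simps)
lemma ract_elem: "ract proj_tensor (elem_tensor b c) a = elem_tensor b (c * a)"
  using tclass_map[OF const_cauchy, of "\<lambda>u. fs_ract u a" "norm a" "pair b c"]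
  by (simp add: proj_tensor_def elem_tensor_def proj_norm_ract fs_ract_simps)

end

theory Submission
  imports Defs
begin

text \<open>
  Write \<open>\<pi>\<close> for the diagonal operator, \<open>V\<close> for the dual of the tensor product, and
  \<open>lim\<^sub>e\<close> for the limit along an ultrafilter that refines the bounded approximate identity.
  Bounded functions converge along it (\<open>ultrafilter_tendsto_Lim\<close>).

  The usual proof takes a weak-star cluster point \<open>E\<close> of \<open>e \<otimes> e\<close> in the bidual of the tensor product
  and applies amenability to the derivation \<open>a \<mapsto> \<sigma> a \<cdot> E - E \<cdot> \<sigma> a\<close>, seen as a map into the kernel
  of \<open>\<pi>\<^sup>*\<^sup>*\<close>.  This kernel is the dual of the quotient of \<open>V\<close> by the functionals \<open>g \<circ> \<pi>\<close>.
  The quotient is avoided as follows.  The map \<open>f \<mapsto> f - g\<^sub>f \<circ> \<pi>\<close> with \<open>g\<^sub>f b = lim\<^sub>e f (b \<otimes> e)\<close>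
  is a projection of \<open>V\<close> whose kernel consists of the functionals \<open>g \<circ> \<pi>\<close>; it is called \<open>reduced\<close>
  below.  The left action that it induces on its range is
  \<open>(a \<bullet> f) x = f (x \<cdot> a) - f (\<pi> x \<otimes> a)\<close>, and this formula, together with the ordinary right
  action, makes all of \<open>V\<close> a Banach bimodule (\<open>banach_actions_twisted\<close>).

  On this twisted bimodule \<open>D a f = lim\<^sub>e f (e \<otimes> \<sigma> a)\<close> is a \<open>\<sigma>\<close>-derivation into the dual
  (\<open>left_limit_linear\<close>).  So there is a bounded functional \<open>N\<close> on \<open>V\<close> with
  \<open>lim\<^sub>e f (e \<otimes> \<sigma> a) = N (f \<cdot> \<sigma> a) - N (\<sigma> a \<bullet> f)\<close>, and
  \<open>\<theta> f a = g\<^sub>f (\<sigma> a) + N (reduced f \<cdot> \<sigma> a)\<close> is the map wanted in the first part.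
  For \<open>f = g \<circ> \<pi>\<close> one has \<open>g\<^sub>f = g\<close> and \<open>reduced f = 0\<close>, hence \<open>\<theta> f = g \<circ> \<sigma>\<close>.  The map respects the right
  actions, because \<open>f \<mapsto> g\<^sub>f\<close> and \<open>reduced\<close> do.  For the left actions, \<open>g\<^bsub>\<sigma> b \<cdot> f\<^esub> (\<sigma> a) = f (\<sigma> a \<otimes> \<sigma> b)\<close>
  and \<open>reduced (\<sigma> b \<cdot> f) = \<sigma> b \<bullet> reduced f\<close>; the formula for \<open>N\<close>, applied to \<open>reduced f \<cdot> \<sigma> a\<close>,
  replaces \<open>N ((\<sigma> b \<bullet> reduced f) \<cdot> \<sigma> a)\<close> by
  \<open>N (reduced f \<cdot> \<sigma> (a * b)) - f (\<sigma> a \<otimes> \<sigma> b) + g\<^sub>f (\<sigma> (a * b))\<close>, and the sum is \<open>\<theta> f (a * b)\<close>.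
  The map \<open>\<gamma>\<close> of the second part is the adjoint of \<open>\<theta>\<close>.

  These computations use that \<open>\<pi>\<close> is a bounded bimodule map and the formulas for \<open>\<pi>\<close> and the actions on
  elementary tensors, but neither the universal property nor the completeness of the tensor product.
\<close>

section \<open>Limits along ultrafilters\<close>

text \<open>An ultrafilter is a filter that is minimal among the proper ones.\<close>

definition ultrafilter :: "'a filter \<Rightarrow> bool" where
  "ultrafilter U \<longleftrightarrow> U \<noteq> bot \<and> (\<forall>G\<le>U. G \<noteq> bot \<longrightarrow> G = U)"

lemma ex_ultrafilter_le:
  assumes "F \<noteq> bot"
  shows "\<exists>U\<le>F. ultrafilter U"
proof -
  let ?A = "{G. G \<le> F \<and> G \<noteq> bot}"
  have "\<exists>U\<in>?A. \<forall>G\<in>?A. G \<le> U \<longrightarrow> G = U"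
  proof (rule predicate_Zorn)
    show "partial_order_on ?A (relation_of (\<lambda>H G. G \<le> H) ?A)"
      by (rule partial_order_on_relation_ofI) auto
  next
    fix C assume "C \<in> Chains (relation_of (\<lambda>H G. G \<le> H) ?A)"
    then have C: "\<And>G. G \<in> C \<Longrightarrow> G \<le> F \<and> G \<noteq> bot" "\<And>G H. G \<in> C \<Longrightarrow> H \<in> C \<Longrightarrow> G \<le> H \<or> H \<le> G"
      by (auto simp: Chains_def relation_of_def)
    show "\<exists>U\<in>?A. \<forall>G\<in>C. U \<le> G"
    proof (cases "C = {}")
      case True
      then show ?thesis using assms by auto
    next
      case False
      have "\<exists>x\<in>C. x \<le> inf G H" if "G \<in> C" "H \<in> C" for G H
        using C(2)[OF that] that by (auto intro: le_infI)
      then have "eventually P (Inf C) \<longleftrightarrow> (\<exists>G\<in>C. eventually P G)" for P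
        by (rule eventually_Inf_base[OF False])
      then have "Inf C \<noteq> bot"
        using C(1) by (simp add: trivial_limit_def)
      moreover have "Inf C \<le> F"
        using False C(1) by (meson Inf_lower2 ex_in_conv)
      ultimately show ?thesis by (auto intro: Inf_lower)
    qed
  qed
  then show ?thesis by (auto simp: ultrafilter_def)
qed

text \<open>Along an ultrafilter every function with values in a bounded set converges.  Weak-star limits of
  nets in a dual space are taken pointwise with this lemma.\<close>

lemma ultrafilter_tendsto_Lim:
  fixes \<phi> :: "'a \<Rightarrow> 'b::heine_borel"
  assumes "ultrafilter U" "bounded B" "\<forall>\<^sub>F e in U. \<phi> e \<in> B"
  shows "(\<phi> \<longlongrightarrow> Lim U \<phi>) U"
proof -
  have U: "U \<noteq> bot" "\<And>G. G \<le> U \<Longrightarrow> G \<noteq> bot \<Longrightarrow> G = U"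
    using assms(1) by (auto simp: ultrafilter_def)
  have "compact (closure B)" using assms(2) by simp
  moreover have "filtermap \<phi> U \<noteq> bot" using U(1) by (simp add: filtermap_bot_iff)
  moreover have "\<forall>\<^sub>F y in filtermap \<phi> U. y \<in> closure B"
    unfolding eventually_filtermap using assms(3) closure_subset by (auto elim!: eventually_mono)
  ultimately obtain l where l: "inf (nhds l) (filtermap \<phi> U) \<noteq> bot"
    unfolding compact_filter by meson
  have "inf (filtercomap \<phi> (nhds l)) U \<noteq> bot"
  proof
    assume "inf (filtercomap \<phi> (nhds l)) U = bot"
    then obtain P Q where PQ: "eventually P (nhds l)" "eventually Q U" "\<And>e. P (\<phi> e) \<Longrightarrow> \<not> Q e"
      by (auto simp: trivial_limit_def eventually_inf eventually_filtercomap)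
    have "eventually (\<lambda>y. \<not> P y) (filtermap \<phi> U)"
      unfolding eventually_filtermap using PQ(2) by (rule eventually_mono) (use PQ(3) in blast)
    then have "inf (nhds l) (filtermap \<phi> U) = bot"
      using PQ(1) by (auto simp: trivial_limit_def eventually_inf)
    with l show False by simp
  qed
  then have "inf (filtercomap \<phi> (nhds l)) U = U" by (intro U(2)) auto
  then have "U \<le> filtercomap \<phi> (nhds l)" by (metis inf.cobounded1)
  then have "(\<phi> \<longlongrightarrow> l) U" by (simp add: filterlim_iff_le_filtercomap)
  then show ?thesis using tendsto_Lim[OF U(1)] by metis
qed


section \<open>Normed spaces with a carrier and their duals\<close>

lemma complex_ring_simps [simp]:
  "carrier complex_ring = UNIV" "x \<otimes>\<^bsub>complex_ring\<^esub> y = x * y" "\<one>\<^bsub>complex_ring\<^esub> = 1"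
  "\<zero>\<^bsub>complex_ring\<^esub> = 0" "x \<oplus>\<^bsub>complex_ring\<^esub> y = x + y"
  by (simp_all add: complex_ring_def)

lemma cring_complex_ring: "cring complex_ring"
proof (rule cringI)
  show "abelian_group complex_ring"
    by (rule abelian_groupI) (auto intro: exI[of _ "- _"])
  show "Group.comm_monoid complex_ring"
    by (rule comm_monoidI) auto
qed (auto simp: distrib_right)

lemma normed_spaceI:
  fixes X :: "('x, 'm) nspace_scheme" (structure)
  assumes "\<And>x y. x \<in> carrier X \<Longrightarrow> y \<in> carrier X \<Longrightarrow> x \<oplus> y \<in> carrier X"
    and "\<zero> \<in> carrier X"
    and "\<And>c x. x \<in> carrier X \<Longrightarrow> c \<odot> x \<in> carrier X"
    and "\<And>x y z. x \<in> carrier X \<Longrightarrow> y \<in> carrier X \<Longrightarrow> z \<in> carrier X \<Longrightarrow> (x \<oplus> y) \<oplus> z = x \<oplus> (y \<oplus> z)"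
    and "\<And>x y. x \<in> carrier X \<Longrightarrow> y \<in> carrier X \<Longrightarrow> x \<oplus> y = y \<oplus> x"
    and "\<And>x. x \<in> carrier X \<Longrightarrow> \<zero> \<oplus> x = x"
    and "\<And>x. x \<in> carrier X \<Longrightarrow> 0 \<odot> x = \<zero>"
    and "\<And>x. x \<in> carrier X \<Longrightarrow> 1 \<odot> x = x"
    and "\<And>c d x. x \<in> carrier X \<Longrightarrow> (c + d) \<odot> x = c \<odot> x \<oplus> d \<odot> x"
    and "\<And>c d x. x \<in> carrier X \<Longrightarrow> (c * d) \<odot> x = c \<odot> (d \<odot> x)"
    and "\<And>c x y. x \<in> carrier X \<Longrightarrow> y \<in> carrier X \<Longrightarrow> c \<odot> (x \<oplus> y) = c \<odot> x \<oplus> c \<odot> y"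
    and "\<And>x. x \<in> carrier X \<Longrightarrow> 0 \<le> vnorm X x"
    and "\<And>x. x \<in> carrier X \<Longrightarrow> vnorm X x = 0 \<Longrightarrow> x = \<zero>"
    and "\<And>x y. x \<in> carrier X \<Longrightarrow> y \<in> carrier X \<Longrightarrow> vnorm X (x \<oplus> y) \<le> vnorm X x + vnorm X y"
    and "\<And>c x. x \<in> carrier X \<Longrightarrow> vnorm X (c \<odot> x) = cmod c * vnorm X x"
  shows "normed_space X"
proof -
  have "abelian_group X"
  proof (rule abelian_groupI)
    fix x assume "x \<in> carrier X"
    then show "\<exists>y\<in>carrier X. y \<oplus> x = \<zero>"
      using assms(9)[of x "-1" 1] assms(3,7,8) by (intro bexI[of _ "(-1) \<odot> x"]) auto
  qed (rule assms(1,2,4-6); assumption)+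
  then have "Module.module complex_ring X"
    by (intro moduleI cring_complex_ring) (simp_all add: assms(3,8-11))
  moreover have "vnorm X \<zero> = 0"
    using assms(15)[OF assms(2), of 0] assms(7)[OF assms(2)] by simp
  ultimately show ?thesis
    unfolding normed_space_def using assms(12-15) by blast
qed

lemma normed_spaceD:
  fixes X :: "('x, 'm) nspace_scheme" (structure)
  assumes "normed_space X"
  shows "x \<in> carrier X \<Longrightarrow> y \<in> carrier X \<Longrightarrow> x \<oplus> y \<in> carrier X"
    and "\<zero> \<in> carrier X"
    and "x \<in> carrier X \<Longrightarrow> c \<odot> x \<in> carrier X"
    and "x \<in> carrier X \<Longrightarrow> y \<in> carrier X \<Longrightarrow> z \<in> carrier X \<Longrightarrow> (x \<oplus> y) \<oplus> z = x \<oplus> (y \<oplus> z)"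
    and "x \<in> carrier X \<Longrightarrow> y \<in> carrier X \<Longrightarrow> x \<oplus> y = y \<oplus> x"
    and "x \<in> carrier X \<Longrightarrow> \<zero> \<oplus> x = x"
    and "x \<in> carrier X \<Longrightarrow> 0 \<odot> x = \<zero>"
    and "x \<in> carrier X \<Longrightarrow> 1 \<odot> x = x"
    and "x \<in> carrier X \<Longrightarrow> (c + d) \<odot> x = c \<odot> x \<oplus> d \<odot> x"
    and "x \<in> carrier X \<Longrightarrow> (c * d) \<odot> x = c \<odot> (d \<odot> x)"
    and "x \<in> carrier X \<Longrightarrow> y \<in> carrier X \<Longrightarrow> c \<odot> (x \<oplus> y) = c \<odot> x \<oplus> c \<odot> y"
    and "x \<in> carrier X \<Longrightarrow> 0 \<le> vnorm X x"
    and "x \<in> carrier X \<Longrightarrow> vnorm X x = 0 \<longleftrightarrow> x = \<zero>"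
    and "x \<in> carrier X \<Longrightarrow> y \<in> carrier X \<Longrightarrow> vnorm X (x \<oplus> y) \<le> vnorm X x + vnorm X y"
    and "x \<in> carrier X \<Longrightarrow> vnorm X (c \<odot> x) = cmod c * vnorm X x"
    and "x \<in> carrier X \<Longrightarrow> y \<in> carrier X \<Longrightarrow> x \<ominus> y = x \<oplus> (-1) \<odot> y"
proof -
  interpret module complex_ring X using assms by (simp add: normed_space_def)
  note s = smult_closed[simplified] smult_l_distr[simplified] smult_r_distr[simplified]
    smult_assoc1[simplified] smult_one[simplified] smult_l_null[simplified]
  show "x \<in> carrier X \<Longrightarrow> y \<in> carrier X \<Longrightarrow> x \<oplus> y \<in> carrier X"
    "\<zero> \<in> carrier X"
    "x \<in> carrier X \<Longrightarrow> c \<odot> x \<in> carrier X"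
    "x \<in> carrier X \<Longrightarrow> y \<in> carrier X \<Longrightarrow> z \<in> carrier X \<Longrightarrow> (x \<oplus> y) \<oplus> z = x \<oplus> (y \<oplus> z)"
    "x \<in> carrier X \<Longrightarrow> y \<in> carrier X \<Longrightarrow> x \<oplus> y = y \<oplus> x"
    "x \<in> carrier X \<Longrightarrow> \<zero> \<oplus> x = x"
    "x \<in> carrier X \<Longrightarrow> 0 \<odot> x = \<zero>"
    "x \<in> carrier X \<Longrightarrow> 1 \<odot> x = x"
    "x \<in> carrier X \<Longrightarrow> (c + d) \<odot> x = c \<odot> x \<oplus> d \<odot> x"
    "x \<in> carrier X \<Longrightarrow> (c * d) \<odot> x = c \<odot> (d \<odot> x)"
    "x \<in> carrier X \<Longrightarrow> y \<in> carrier X \<Longrightarrow> c \<odot> (x \<oplus> y) = c \<odot> x \<oplus> c \<odot> y"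
    by (simp_all add: s M.a_ac)
  show "x \<in> carrier X \<Longrightarrow> 0 \<le> vnorm X x"
    "x \<in> carrier X \<Longrightarrow> vnorm X x = 0 \<longleftrightarrow> x = \<zero>"
    "x \<in> carrier X \<Longrightarrow> y \<in> carrier X \<Longrightarrow> vnorm X (x \<oplus> y) \<le> vnorm X x + vnorm X y"
    "x \<in> carrier X \<Longrightarrow> vnorm X (c \<odot> x) = cmod c * vnorm X x"
    using assms unfolding normed_space_def by blast+
  show "x \<in> carrier X \<Longrightarrow> y \<in> carrier X \<Longrightarrow> x \<ominus> y = x \<oplus> (-1) \<odot> y"
  proof -
    assume xy: "x \<in> carrier X" "y \<in> carrier X"
    have "\<ominus>\<^bsub>complex_ring\<^esub> 1 = (-1::complex)"
      by (rule R.minus_equality) auto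
    then have "(-1) \<odot> y = \<ominus> y"
      using smult_l_minus[of 1 y] xy by (simp add: s)
    then show "x \<ominus> y = x \<oplus> (-1) \<odot> y" by (simp add: a_minus_def)
  qed
qed


lemma normed_space_diff_commute:
  fixes X :: "('x, 'm) nspace_scheme" (structure)
  assumes "normed_space X" "x \<in> carrier X" "y \<in> carrier X"
  shows "vnorm X (x \<ominus> y) = vnorm X (y \<ominus> x)"
proof -
  note X = normed_spaceD[OF assms(1)]
  have "(-1) \<odot> (y \<ominus> x) = (-1) \<odot> y \<oplus> ((-1) * (-1)) \<odot> x"
    using assms(2,3) by (simp only: X)
  also have "\<dots> = x \<ominus> y"
    using assms(2,3) by (simp add: X(3,5,8,16))
  finally show ?thesis
    using X(15)[of "y \<ominus> x" "-1"] assms(2,3) X(1,3,16) by simp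
qed

lemma normed_space_dist_triangle:
  fixes X :: "('x, 'm) nspace_scheme" (structure)
  assumes "normed_space X" "x \<in> carrier X" "y \<in> carrier X" "z \<in> carrier X"
  shows "vnorm X (x \<ominus> z) \<le> vnorm X (x \<ominus> y) + vnorm X (y \<ominus> z)"
proof -
  note X = normed_spaceD[OF assms(1)]
  have "(-1) \<odot> y \<oplus> y = \<zero>"
    using assms(3) X(9)[of y "-1" 1] by (simp add: X(7,8))
  then have "(-1) \<odot> y \<oplus> (y \<oplus> (-1) \<odot> z) = (-1) \<odot> z"
    using assms(3,4) X(4)[of "(-1) \<odot> y" y "(-1) \<odot> z"] by (simp add: X(3,6))
  then have "x \<ominus> z = (x \<ominus> y) \<oplus> (y \<ominus> z)"
    using assms(2-4) by (simp add: X(1,3,4,16))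
  then show ?thesis
    using assms(2-4) X(14)[of "x \<ominus> y" "y \<ominus> z"] by (simp add: X(1,3,16))
qed

lemma normed_space_dist_eq_0:
  fixes X :: "('x, 'm) nspace_scheme" (structure)
  assumes "normed_space X" "x \<in> carrier X" "y \<in> carrier X" "vnorm X (x \<ominus> y) = 0"
  shows "x = y"
proof -
  note X = normed_spaceD[OF assms(1)]
  have "x \<oplus> (-1) \<odot> y = \<zero>"
    using assms(2-4) X(1,3,13,16) by metis
  moreover have "(-1) \<odot> y \<oplus> y = \<zero>"
    using assms(3) X(9)[of y "-1" 1] by (simp add: X(7,8))
  then have "(x \<oplus> (-1) \<odot> y) \<oplus> y = x"
    using assms(2,3) by (metis X(2-6))
  ultimately show ?thesis
    using assms(3) X(6) by simp
qed

text \<open>Completeness of a normed space in terms of the Cauchy sequences in its carrier.  Unlike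
  \<^term>\<open>Metric_space.mcomplete\<close>, whose theory needs a distance that is nonnegative and symmetric
  for all elements of the underlying type, it involves elements of the carrier only.\<close>

definition seq_complete :: "('x, 'm) nspace_scheme \<Rightarrow> bool" where
  "seq_complete X \<longleftrightarrow>
     (\<forall>s. (\<forall>n. s n \<in> carrier X) \<longrightarrow>
        (\<forall>\<epsilon>>0. \<exists>N. \<forall>m\<ge>N. \<forall>n\<ge>N. vnorm X (s m \<ominus>\<^bsub>X\<^esub> s n) < \<epsilon>) \<longrightarrow>
        (\<exists>l\<in>carrier X. (\<lambda>n. vnorm X (s n \<ominus>\<^bsub>X\<^esub> l)) \<longlonglongrightarrow> 0))"

lemma carrier_dual_iff:
  "f \<in> carrier (dual X) \<longleftrightarrow>
     f \<in> extensional (carrier X) \<and>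
     (\<forall>x\<in>carrier X. \<forall>y\<in>carrier X. f (x \<oplus>\<^bsub>X\<^esub> y) = f x + f y) \<and>
     (\<forall>c. \<forall>x\<in>carrier X. f (c \<odot>\<^bsub>X\<^esub> x) = c * f x) \<and>
     (\<exists>K. \<forall>x\<in>carrier X. cmod (f x) \<le> K * vnorm X x)"
  by (auto simp: dual_def bounded_linear_map_def scalars_def)

lemma functionalD:
  assumes "f \<in> carrier (dual X)"
  shows "f \<in> extensional (carrier X)"
    and "x \<in> carrier X \<Longrightarrow> y \<in> carrier X \<Longrightarrow> f (x \<oplus>\<^bsub>X\<^esub> y) = f x + f y"
    and "x \<in> carrier X \<Longrightarrow> f (c \<odot>\<^bsub>X\<^esub> x) = c * f x"
  using assms by (auto simp: carrier_dual_iff)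

lemma restrict_functionalI:
  assumes "normed_space X"
    and "\<And>x y. x \<in> carrier X \<Longrightarrow> y \<in> carrier X \<Longrightarrow> h (x \<oplus>\<^bsub>X\<^esub> y) = h x + h y"
    and "\<And>c x. x \<in> carrier X \<Longrightarrow> h (c \<odot>\<^bsub>X\<^esub> x) = c * h x"
    and "\<And>x. x \<in> carrier X \<Longrightarrow> cmod (h x) \<le> K * vnorm X x"
  shows "(\<lambda>x\<in>carrier X. h x) \<in> carrier (dual X)"
  unfolding carrier_dual_iff
  by (auto simp: assms(2-4) normed_spaceD(1,3)[OF assms(1)] intro!: exI[of _ K])

lemma functional_le:
  assumes X: "normed_space X" and f: "f \<in> carrier (dual X)" and x: "x \<in> carrier X"
  shows "cmod (f x) \<le> vnorm (dual X) f * vnorm X x"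
proof -
  note D = normed_spaceD[OF X]
  obtain K where K: "\<And>x. x \<in> carrier X \<Longrightarrow> cmod (f x) \<le> K * vnorm X x"
    using f unfolding carrier_dual_iff by blast
  show ?thesis
  proof (cases "vnorm X x = 0")
    case True
    then show ?thesis using K[OF x] by simp
  next
    case False
    then have pos: "vnorm X x > 0" using D(12)[OF x] by simp
    \<comment> \<open>The dual norm is a supremum over the unit ball, so \<open>x\<close> is scaled to norm one.\<close>
    let ?c = "complex_of_real (1 / vnorm X x)"
    let ?y = "?c \<odot>\<^bsub>X\<^esub> x"
    have y: "?y \<in> carrier X" "vnorm X ?y \<le> 1"
      using x pos D(3) D(15)[OF x, of ?c] by (auto simp: norm_divide)
    have "cmod (f z) \<le> \<bar>K\<bar>" if "z \<in> carrier X" "vnorm X z \<le> 1" for z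
    proof -
      have "K * vnorm X z \<le> \<bar>K\<bar> * 1"
        using that D(12)[OF that(1)] by (intro mult_mono) auto
      with K[OF that(1)] show ?thesis by simp
    qed
    then have "cmod (f ?y) \<le> vnorm (dual X) f"
      unfolding dual_def using y by (auto intro!: cSUP_upper bdd_aboveI[of _ "\<bar>K\<bar>"])
    moreover have "cmod (f ?y) = cmod (f x) / vnorm X x"
      using functionalD(3)[OF f x, of ?c] pos by (simp add: norm_mult norm_divide)
    ultimately show ?thesis using pos pos_divide_le_eq by metis
  qed
qed

lemma dual_norm_leI:
  assumes X: "normed_space X" and "0 \<le> K"
    and "\<And>x. x \<in> carrier X \<Longrightarrow> cmod (f x) \<le> K * vnorm X x"
  shows "vnorm (dual X) f \<le> K"
proof -
  note D = normed_spaceD[OF X]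
  have "vnorm X \<zero>\<^bsub>X\<^esub> = 0" using D(2,13) by blast
  then have "{x \<in> carrier X. vnorm X x \<le> 1} \<noteq> {}" using D(2) by force
  moreover have "cmod (f x) \<le> K" if "x \<in> carrier X" "vnorm X x \<le> 1" for x
    using assms(3)[OF that(1)] mult_left_le[OF that(2) assms(2)] by linarith
  ultimately show ?thesis by (auto simp: dual_def intro!: cSUP_least)
qed

lemma dual_norm_nonneg:
  assumes X: "normed_space X" and f: "f \<in> carrier (dual X)"
  shows "0 \<le> vnorm (dual X) f"
proof -
  obtain K where K: "\<And>x. x \<in> carrier X \<Longrightarrow> cmod (f x) \<le> K * vnorm X x"
    using f unfolding carrier_dual_iff by blast
  have "cmod (f z) \<le> \<bar>K\<bar>" if "z \<in> carrier X" "vnorm X z \<le> 1" for z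
  proof -
    have "K * vnorm X z \<le> \<bar>K\<bar> * 1"
      using that normed_spaceD(12)[OF X that(1)] by (intro mult_mono) auto
    with K[OF that(1)] show ?thesis by simp
  qed
  moreover have "vnorm X \<zero>\<^bsub>X\<^esub> = 0" using normed_spaceD(2,13)[OF X] by blast
  ultimately have "cmod (f \<zero>\<^bsub>X\<^esub>) \<le> vnorm (dual X) f"
    unfolding dual_def using normed_spaceD(2)[OF X]
    by (auto intro!: cSUP_upper bdd_aboveI[of _ "\<bar>K\<bar>"])
  then show ?thesis using norm_ge_zero order_trans by blast
qed

lemma dual_simps:
  "\<zero>\<^bsub>dual X\<^esub> = (\<lambda>x\<in>carrier X. 0)"
  "f \<oplus>\<^bsub>dual X\<^esub> g = (\<lambda>x\<in>carrier X. f x + g x)"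
  "c \<odot>\<^bsub>dual X\<^esub> f = (\<lambda>x\<in>carrier X. c * f x)"
  "lact (dual X) a f = (\<lambda>x\<in>carrier X. f (ract X x a))"
  "ract (dual X) f a = (\<lambda>x\<in>carrier X. f (lact X a x))"
  by (simp_all add: dual_def)

lemma normed_space_dual:
  assumes X: "normed_space X"
  shows "normed_space (dual X)"
proof (rule normed_spaceI)
  note D = normed_spaceD[OF X]
  have ext: "f = g" if "f \<in> carrier (dual X)" "g \<in> carrier (dual X)" "\<And>x. x \<in> carrier X \<Longrightarrow> f x = g x" for f g
    using that functionalD(1) extensionalityI by metis
  have add: "f \<oplus>\<^bsub>dual X\<^esub> g \<in> carrier (dual X)" if fg: "f \<in> carrier (dual X)" "g \<in> carrier (dual X)" for f g
    unfolding dual_simps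
  proof (rule restrict_functionalI[OF X])
    fix x assume "x \<in> carrier X"
    then show "cmod (f x + g x) \<le> (vnorm (dual X) f + vnorm (dual X) g) * vnorm X x"
      using functional_le[OF X fg(1)] functional_le[OF X fg(2)]
      by (smt (verit) distrib_right norm_triangle_ineq)
  qed (auto simp: functionalD[OF fg(1)] functionalD[OF fg(2)] algebra_simps)
  have scale: "c \<odot>\<^bsub>dual X\<^esub> f \<in> carrier (dual X)" if f: "f \<in> carrier (dual X)" for f c
    unfolding dual_simps
  proof (rule restrict_functionalI[OF X])
    fix x assume "x \<in> carrier X"
    then show "cmod (c * f x) \<le> (cmod c * vnorm (dual X) f) * vnorm X x"
      using functional_le[OF X f] by (simp add: norm_mult mult.assoc mult_left_mono)
  qed (auto simp: functionalD[OF f] algebra_simps)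
  have zero: "\<zero>\<^bsub>dual X\<^esub> \<in> carrier (dual X)"
    unfolding dual_simps by (rule restrict_functionalI[OF X, of _ 0]) auto
  show "\<zero>\<^bsub>dual X\<^esub> \<in> carrier (dual X)" by (rule zero)
  fix f assume f: "f \<in> carrier (dual X)"
  show "0 \<le> vnorm (dual X) f" by (rule dual_norm_nonneg[OF X f])
  show "c \<odot>\<^bsub>dual X\<^esub> f \<in> carrier (dual X)" for c by (rule scale[OF f])
  show "f = \<zero>\<^bsub>dual X\<^esub>" if "vnorm (dual X) f = 0"
    using functional_le[OF X f] that by (intro ext f zero) (simp add: dual_simps)
  show "0 \<odot>\<^bsub>dual X\<^esub> f = \<zero>\<^bsub>dual X\<^esub>" by (simp add: dual_simps)
  show "1 \<odot>\<^bsub>dual X\<^esub> f = f" by (intro ext scale f) (simp add: dual_simps)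
  show "\<zero>\<^bsub>dual X\<^esub> \<oplus>\<^bsub>dual X\<^esub> f = f" by (intro ext add zero f) (simp add: dual_simps)
  show "(c + d) \<odot>\<^bsub>dual X\<^esub> f = c \<odot>\<^bsub>dual X\<^esub> f \<oplus>\<^bsub>dual X\<^esub> d \<odot>\<^bsub>dual X\<^esub> f" for c d
    by (intro ext scale add f) (simp add: dual_simps distrib_right)
  show "(c * d) \<odot>\<^bsub>dual X\<^esub> f = c \<odot>\<^bsub>dual X\<^esub> (d \<odot>\<^bsub>dual X\<^esub> f)" for c d
    by (intro ext scale f) (simp add: dual_simps)
  show nscale: "vnorm (dual X) (c \<odot>\<^bsub>dual X\<^esub> f) = cmod c * vnorm (dual X) f" for c
  proof -
    have le: "vnorm (dual X) (c \<odot>\<^bsub>dual X\<^esub> f) \<le> cmod c * vnorm (dual X) f" if "f \<in> carrier (dual X)" for c f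
      using functional_le[OF X that] dual_norm_nonneg[OF X that]
      by (intro dual_norm_leI[OF X]) (auto simp: dual_simps norm_mult mult.assoc intro!: mult_left_mono)
    show ?thesis
    proof (cases "c = 0")
      case True
      then show ?thesis using le[OF f, of c] dual_norm_nonneg[OF X scale[OF f], of c] by simp
    next
      case False
      \<comment> \<open>The reverse inequality is the one just shown, for the factor \<open>inverse c\<close>.\<close>
      have "inverse c \<odot>\<^bsub>dual X\<^esub> (c \<odot>\<^bsub>dual X\<^esub> f) = f"
        using False by (intro ext scale f) (simp add: dual_simps)
      then have "vnorm (dual X) f \<le> cmod (inverse c) * vnorm (dual X) (c \<odot>\<^bsub>dual X\<^esub> f)"
        using le[OF scale[OF f], of "inverse c" c] by simp
      then have "cmod c * vnorm (dual X) f \<le> vnorm (dual X) (c \<odot>\<^bsub>dual X\<^esub> f)"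
        using False mult_left_mono[OF _ norm_ge_zero[of c]]
        by (fastforce simp: norm_inverse mult.assoc[symmetric])
      then show ?thesis using le[OF f, of c] by simp
    qed
  qed
  fix g assume g: "g \<in> carrier (dual X)"
  show "f \<oplus>\<^bsub>dual X\<^esub> g \<in> carrier (dual X)" by (rule add[OF f g])
  show "f \<oplus>\<^bsub>dual X\<^esub> g = g \<oplus>\<^bsub>dual X\<^esub> f" by (simp add: dual_simps add.commute)
  show "c \<odot>\<^bsub>dual X\<^esub> (f \<oplus>\<^bsub>dual X\<^esub> g) = c \<odot>\<^bsub>dual X\<^esub> f \<oplus>\<^bsub>dual X\<^esub> c \<odot>\<^bsub>dual X\<^esub> g" for c
    by (intro ext scale add f g) (simp add: dual_simps distrib_left)
  show "vnorm (dual X) (f \<oplus>\<^bsub>dual X\<^esub> g) \<le> vnorm (dual X) f + vnorm (dual X) g"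
  proof (rule dual_norm_leI[OF X])
    fix x assume x: "x \<in> carrier X"
    then show "cmod ((f \<oplus>\<^bsub>dual X\<^esub> g) x) \<le> (vnorm (dual X) f + vnorm (dual X) g) * vnorm X x"
      using functional_le[OF X f x] functional_le[OF X g x] norm_triangle_ineq[of "f x" "g x"]
      by (simp add: dual_simps distrib_right)
  qed (use dual_norm_nonneg[OF X] f g in auto)
  fix h assume h: "h \<in> carrier (dual X)"
  show "(f \<oplus>\<^bsub>dual X\<^esub> g) \<oplus>\<^bsub>dual X\<^esub> h = f \<oplus>\<^bsub>dual X\<^esub> (g \<oplus>\<^bsub>dual X\<^esub> h)"
    by (intro ext add f g h) (simp add: dual_simps)
qed

lemma dual_minus_apply:
  assumes "normed_space X" "f \<in> carrier (dual X)" "g \<in> carrier (dual X)" "x \<in> carrier X"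
  shows "(f \<ominus>\<^bsub>dual X\<^esub> g) x = f x - g x"
  using normed_spaceD(16)[OF normed_space_dual[OF assms(1)] assms(2,3)] assms(4)
  by (simp add: dual_simps)

lemma seq_complete_dual:
  assumes X: "normed_space X"
  shows "seq_complete (dual X)"
  unfolding seq_complete_def
proof (intro allI impI)
  fix s :: "nat \<Rightarrow> _" assume s: "\<forall>n. s n \<in> carrier (dual X)"
    and cauchy: "\<forall>\<epsilon>>0. \<exists>N. \<forall>m\<ge>N. \<forall>n\<ge>N. vnorm (dual X) (s m \<ominus>\<^bsub>dual X\<^esub> s n) < \<epsilon>"
  note D = normed_spaceD[OF normed_space_dual[OF X]]
  have sc: "s n \<in> carrier (dual X)" for n using s by blast
  have diff: "f \<ominus>\<^bsub>dual X\<^esub> g \<in> carrier (dual X)" if "f \<in> carrier (dual X)" "g \<in> carrier (dual X)" for f g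
    using that D(1,3,16) by simp
  have *: "cmod (s m x - s n x) \<le> vnorm (dual X) (s m \<ominus>\<^bsub>dual X\<^esub> s n) * vnorm X x" if "x \<in> carrier X" for m n x
    using functional_le[OF X diff[OF sc sc] that] dual_minus_apply[OF X sc sc that] by metis
  have "\<exists>l. (\<lambda>n. s n x) \<longlonglongrightarrow> l" if x: "x \<in> carrier X" for x
  proof -
    have nx: "0 \<le> vnorm X x" using normed_spaceD(12)[OF X x] .
    have "Cauchy (\<lambda>n. s n x)"
      unfolding Cauchy_def dist_norm
    proof (intro allI impI)
      fix \<epsilon> :: real assume "\<epsilon> > 0"
      then have "\<epsilon> / (vnorm X x + 1) > 0" using nx by simp
      then obtain N where N: "\<And>m n. m \<ge> N \<Longrightarrow> n \<ge> N \<Longrightarrow> vnorm (dual X) (s m \<ominus>\<^bsub>dual X\<^esub> s n) < \<epsilon> / (vnorm X x + 1)"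
        using cauchy by blast
      have "cmod (s m x - s n x) < \<epsilon>" if "m \<ge> N" "n \<ge> N" for m n
      proof -
        have "cmod (s m x - s n x) \<le> vnorm (dual X) (s m \<ominus>\<^bsub>dual X\<^esub> s n) * (vnorm X x + 1)"
          using *[OF x, of m n] dual_norm_nonneg[OF X diff[OF sc sc], of m n] by (simp add: distrib_left)
        also have "\<dots> < \<epsilon>" using N[OF that] nx by (simp add: field_simps)
        finally show ?thesis .
      qed
      then show "\<exists>M. \<forall>m\<ge>M. \<forall>n\<ge>M. cmod (s m x - s n x) < \<epsilon>" by blast
    qed
    then show ?thesis by (simp add: Cauchy_convergent_iff convergent_def)
  qed
  then obtain l where l: "\<And>x. x \<in> carrier X \<Longrightarrow> (\<lambda>n. s n x) \<longlonglongrightarrow> l x" by metis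
  have close: "\<exists>N. \<forall>n\<ge>N. \<forall>x\<in>carrier X. cmod (s n x - l x) \<le> \<epsilon> * vnorm X x" if "\<epsilon> > 0" for \<epsilon>
  proof -
    obtain N where N: "\<And>m n. m \<ge> N \<Longrightarrow> n \<ge> N \<Longrightarrow> vnorm (dual X) (s m \<ominus>\<^bsub>dual X\<^esub> s n) < \<epsilon>"
      using cauchy \<open>\<epsilon> > 0\<close> by blast
    have "cmod (s n x - l x) \<le> \<epsilon> * vnorm X x" if "n \<ge> N" "x \<in> carrier X" for n x
    proof (rule Lim_bounded)
      show "(\<lambda>m. cmod (s n x - s m x)) \<longlonglongrightarrow> cmod (s n x - l x)"
        by (intro tendsto_intros l that)
      show "\<forall>m\<ge>N. cmod (s n x - s m x) \<le> \<epsilon> * vnorm X x"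
        using *[OF that(2), of n] N[OF that(1)] normed_spaceD(12)[OF X that(2)]
        by (meson less_imp_le mult_right_mono order_trans)
    qed
    then show ?thesis by blast
  qed
  let ?l = "\<lambda>x\<in>carrier X. l x"
  have lc: "?l \<in> carrier (dual X)"
  proof -
    obtain N where N: "\<And>x. x \<in> carrier X \<Longrightarrow> cmod (s N x - l x) \<le> 1 * vnorm X x"
      using close[of 1] by auto
    show ?thesis
    proof (rule restrict_functionalI[OF X])
      fix x y assume xy: "x \<in> carrier X" "y \<in> carrier X"
      have "(\<lambda>n. s n (x \<oplus>\<^bsub>X\<^esub> y)) \<longlonglongrightarrow> l x + l y"
        unfolding functionalD(2)[OF sc xy] by (intro tendsto_intros l xy)
      then show "l (x \<oplus>\<^bsub>X\<^esub> y) = l x + l y"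
        using l[OF normed_spaceD(1)[OF X xy]] LIMSEQ_unique by blast
    next
      fix c x assume x: "x \<in> carrier X"
      have "(\<lambda>n. s n (c \<odot>\<^bsub>X\<^esub> x)) \<longlonglongrightarrow> c * l x"
        unfolding functionalD(3)[OF sc x] by (intro tendsto_intros l x)
      then show "l (c \<odot>\<^bsub>X\<^esub> x) = c * l x"
        using l[OF normed_spaceD(3)[OF X x]] LIMSEQ_unique by blast
    next
      fix x assume x: "x \<in> carrier X"
      show "cmod (l x) \<le> (vnorm (dual X) (s N) + 1) * vnorm X x"
        using N[OF x] functional_le[OF X sc x, of N] norm_triangle_ineq2[of "l x" "s N x"]
        by (simp add: distrib_right norm_minus_commute)
    qed
  qed
  have "(\<lambda>n. vnorm (dual X) (s n \<ominus>\<^bsub>dual X\<^esub> ?l)) \<longlonglongrightarrow> 0"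
  proof (rule LIMSEQ_I)
    fix \<epsilon> :: real assume "\<epsilon> > 0"
    then obtain N where N: "\<And>n x. n \<ge> N \<Longrightarrow> x \<in> carrier X \<Longrightarrow> cmod (s n x - l x) \<le> \<epsilon>/2 * vnorm X x"
      using close[of "\<epsilon>/2"] by auto
    have "norm (vnorm (dual X) (s n \<ominus>\<^bsub>dual X\<^esub> ?l) - 0) < \<epsilon>" if "n \<ge> N" for n
    proof -
      have "vnorm (dual X) (s n \<ominus>\<^bsub>dual X\<^esub> ?l) \<le> \<epsilon>/2"
        using N[OF that] \<open>\<epsilon> > 0\<close> by (intro dual_norm_leI[OF X]) (simp_all add: dual_minus_apply[OF X sc lc])
      then show ?thesis using dual_norm_nonneg[OF X diff[OF sc lc], of n] \<open>\<epsilon> > 0\<close> by simp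
    qed
    then show "\<exists>no. \<forall>n\<ge>no. norm (vnorm (dual X) (s n \<ominus>\<^bsub>dual X\<^esub> ?l) - 0) < \<epsilon>" by blast
  qed
  with lc show "\<exists>l\<in>carrier (dual X). (\<lambda>n. vnorm (dual X) (s n \<ominus>\<^bsub>dual X\<^esub> l)) \<longlonglongrightarrow> 0" by blast
qed

lemma dual_map_bounded:
  fixes X :: "('a, 'x) bimodule" and Y :: "('a, 'y) bimodule"
  assumes X: "normed_space X" and Y: "normed_space Y" and T: "bounded_linear_map X Y T"
  shows "bounded_linear_map (dual Y) (dual X) (dual_map X T)"
proof -
  have T': "\<And>x. x \<in> carrier X \<Longrightarrow> T x \<in> carrier Y"
    "\<And>x y. x \<in> carrier X \<Longrightarrow> y \<in> carrier X \<Longrightarrow> T (x \<oplus>\<^bsub>X\<^esub> y) = T x \<oplus>\<^bsub>Y\<^esub> T y"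
    "\<And>c x. x \<in> carrier X \<Longrightarrow> T (c \<odot>\<^bsub>X\<^esub> x) = c \<odot>\<^bsub>Y\<^esub> T x"
    using T by (auto simp: bounded_linear_map_def)
  obtain K where K: "\<And>x. x \<in> carrier X \<Longrightarrow> vnorm Y (T x) \<le> K * vnorm X x"
    using T unfolding bounded_linear_map_def by blast
  have le: "cmod (f (T x)) \<le> (\<bar>K\<bar> * vnorm (dual Y) f) * vnorm X x"
    if f: "f \<in> carrier (dual Y)" and x: "x \<in> carrier X" for f x
  proof -
    have "cmod (f (T x)) \<le> vnorm (dual Y) f * vnorm Y (T x)"
      by (rule functional_le[OF Y f T'(1)[OF x]])
    also have "\<dots> \<le> vnorm (dual Y) f * (\<bar>K\<bar> * vnorm X x)"
    proof (rule mult_left_mono)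
      have "K * vnorm X x \<le> \<bar>K\<bar> * vnorm X x"
        using normed_spaceD(12)[OF X x] by (simp add: mult_right_mono)
      then show "vnorm Y (T x) \<le> \<bar>K\<bar> * vnorm X x" using K[OF x] by linarith
    qed (rule dual_norm_nonneg[OF Y f])
    finally show ?thesis by (simp add: mult_ac)
  qed
  have car: "dual_map X T f \<in> carrier (dual X)" if f: "f \<in> carrier (dual Y)" for f
    unfolding dual_map_def
    by (rule restrict_functionalI[OF X _ _ le[OF f]]) (simp_all add: T' functionalD[OF f])
  show ?thesis
    unfolding bounded_linear_map_def
  proof (intro conjI ballI allI exI)
    fix f assume f: "f \<in> carrier (dual Y)"
    show "dual_map X T f \<in> carrier (dual X)" by (rule car[OF f])
    show "vnorm (dual X) (dual_map X T f) \<le> \<bar>K\<bar> * vnorm (dual Y) f"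
      using le[OF f] dual_norm_nonneg[OF Y f] by (intro dual_norm_leI[OF X]) (simp_all add: dual_map_def)
  qed (auto simp: dual_map_def dual_simps T'(1))
qed


section \<open>The projective tensor product as a normed bimodule\<close>

lemma formal_sum_induct [case_names zero add]:
  fixes u :: "'a formal_sum"
  assumes "P 0" "\<And>u c a b. P u \<Longrightarrow> P (u + fs_scale c (pair a b))"
  shows "P u"
proof (induction u rule: update_induct)
  case const
  show ?case using assms(1) by (simp add: zero_poly_mapping_def[symmetric])
next
  case (update f z c)
  have "Poly_Mapping.update z c f = f + fs_scale c (pair (fst z) (snd z))"
    using update(1)
    by (auto simp: poly_mapping_eq_iff fun_eq_iff lookup_update lookup_add lookup_single
        lookup_fs_scale when_def in_keys_iff)
  then show ?case using assms(2)[OF update(3), of c "fst z" "snd z"] by metis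
qed

lemma fs_lact_mult: "fs_lact (a * b) u = fs_lact a (fs_lact b u)"
  by (induction u rule: formal_sum_induct)
     (simp_all add: fs_lact_simps fs_lact_add fs_lact_scale mult.assoc)

lemma fs_ract_mult: "fs_ract u (a * b) = fs_ract (fs_ract u a) b"
  by (induction u rule: formal_sum_induct)
     (simp_all add: fs_ract_simps fs_ract_add fs_ract_scale mult.assoc)

lemma fs_lact_ract: "fs_lact a (fs_ract u b) = fs_ract (fs_lact a u) b"
  by (induction u rule: formal_sum_induct)
     (simp_all add: fs_ract_simps fs_ract_add fs_ract_scale fs_lact_simps fs_lact_add fs_lact_scale)

lemma fs_diag_lact: "fs_diag (fs_lact a u) = a * fs_diag u"
  by (induction u rule: formal_sum_induct)
     (simp_all add: fs_diag_simps fs_diag_add fs_diag_scale fs_lact_simps fs_lact_add fs_lact_scale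
        distrib_left mult_scaleC_right mult.assoc)

lemma fs_diag_ract: "fs_diag (fs_ract u a) = fs_diag u * a"
  by (induction u rule: formal_sum_induct)
     (simp_all add: fs_diag_simps fs_diag_add fs_diag_scale fs_ract_simps fs_ract_add fs_ract_scale
        distrib_right mult_scaleC_left mult.assoc)

text \<open>On formal sums the actions are linear in the algebra element only modulo the bilinearity
  relations.\<close>

lemma null_relation_sum:
  assumes "u \<in> tensor_null" "r \<in> bilinear_relations" 
  shows "u + fs_scale c r \<in> tensor_null"
  using assms null_subspace null_base by (blast intro: fs.subspace_add fs.subspace_scale)

lemma fs_act_add_null:
  "fs_lact (a + a') u - (fs_lact a u + fs_lact a' u) \<in> tensor_null"
  "fs_ract u (a + a') - (fs_ract u a + fs_ract u a') \<in> tensor_null"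
proof (induction u rule: formal_sum_induct)
  case zero
  { case 1 then show ?case by (simp add: fs_lact_simps fs.subspace_0[OF null_subspace]) }
  { case 2 then show ?case by (simp add: fs_ract_simps fs.subspace_0[OF null_subspace]) }
next
  case (add u c x y)
  { case 1
    have "pair (a * x + a' * x) y - pair (a * x) y - pair (a' * x) y \<in> bilinear_relations"
      unfolding bilinear_relations_def by blast
    from null_relation_sum[OF add(1) this, of c] show ?case
      by (simp add: fs_lact_add fs_lact_scale distrib_right fs.scale_right_diff_distrib algebra_simps) }
  { case 2
    have "pair x (y * a + y * a') - pair x (y * a) - pair x (y * a') \<in> bilinear_relations"
      unfolding bilinear_relations_def by blast
    from null_relation_sum[OF add(2) this, of c] show ?case
      by (simp add: fs_ract_add fs_ract_scale distrib_left fs.scale_right_diff_distrib algebra_simps) }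
qed

lemma fs_act_scaleC_null:
  "fs_lact (scaleC d a) u - fs_scale d (fs_lact a u) \<in> tensor_null"
  "fs_ract u (scaleC d a) - fs_scale d (fs_ract u a) \<in> tensor_null"
proof (induction u rule: formal_sum_induct)
  case zero
  { case 1 then show ?case by (simp add: fs_lact_simps fs.subspace_0[OF null_subspace]) }
  { case 2 then show ?case by (simp add: fs_ract_simps fs.subspace_0[OF null_subspace]) }
next
  case (add u c x y)
  { case 1
    have "pair (scaleC d (a * x)) y - fs_scale d (pair (a * x) y) \<in> bilinear_relations"
      unfolding bilinear_relations_def by blast
    from null_relation_sum[OF add(1) this, of c] show ?case
      by (simp add: fs_lact_add fs_lact_scale mult_scaleC_left fs.scale_right_diff_distrib 
          fs.scale_right_distrib algebra_simps) }
  { case 2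
    have "pair x (scaleC d (y * a)) - fs_scale d (pair x (y * a)) \<in> bilinear_relations"
      unfolding bilinear_relations_def by blast
    from null_relation_sum[OF add(2) this, of c] show ?case
      by (simp add: fs_ract_add fs_ract_scale mult_scaleC_right fs.scale_right_diff_distrib
          fs.scale_right_distrib algebra_simps) }
qed

lemma proj_norm_scale_le: "proj_norm (fs_scale c u) \<le> cmod c * proj_norm u"
proof (cases "c = 0")
  case True
  then show ?thesis by simp
next
  case False
  then have "proj_norm (fs_scale c u) / cmod c \<le> proj_norm u"
    by (intro proj_norm_ge) (use proj_norm_le[OF rep_cost_scale] in \<open>auto simp: divide_le_eq mult.commute\<close>)
  with False show ?thesis by (simp add: field_simps)
qed

lemma proj_norm_scale: "proj_norm (fs_scale c u) = cmod c * proj_norm u"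
proof (cases "c = 0")
  case True
  then show ?thesis by (simp add: fs.scale_zero_left)
next
  case False
  have "proj_norm u \<le> cmod (inverse c) * proj_norm (fs_scale c u)"
    using proj_norm_scale_le[of "inverse c" "fs_scale c u"] False by (simp add: fs.scale_scale fs.scale_one)
  then have "cmod c * proj_norm u \<le> cmod c * (cmod (inverse c) * proj_norm (fs_scale c u))"
    by (rule mult_left_mono) simp
  also have "\<dots> = proj_norm (fs_scale c u)"
    using False by (simp add: norm_inverse)
  finally show ?thesis using proj_norm_scale_le[of c u] by simp
qed

lemma proj_norm_abs_diff: "\<bar>proj_norm u - proj_norm v\<bar> \<le> proj_norm (u - v)"
  using proj_norm_triangle[of "u - v" v] proj_norm_triangle[of "v - u" u] proj_norm_minus_commute[of u v]
  by simp

lemma cauchy_seqsD: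
  "s \<in> cauchy_seqs \<Longrightarrow> e > 0 \<Longrightarrow> \<exists>N. \<forall>m\<ge>N. \<forall>n\<ge>N. proj_norm (s m - s n) < e"
  by (simp add: cauchy_seqs_def)

lemma cauchy_add:
  assumes "s \<in> cauchy_seqs" "t \<in> cauchy_seqs"
  shows "(\<lambda>n. s n + t n) \<in> cauchy_seqs"
  unfolding cauchy_seqs_def
proof safe
  fix e :: real assume "e > 0"
  then have e2: "e / 2 > 0" by simp
  obtain M where M: "\<And>m n. m \<ge> M \<Longrightarrow> n \<ge> M \<Longrightarrow> proj_norm (s m - s n) < e / 2"
    using cauchy_seqsD[OF assms(1) e2] by blast
  obtain N where N: "\<And>m n. m \<ge> N \<Longrightarrow> n \<ge> N \<Longrightarrow> proj_norm (t m - t n) < e / 2"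
    using cauchy_seqsD[OF assms(2) e2] by blast
  have "proj_norm (s m + t m - (s n + t n)) < e" if "m \<ge> max M N" "n \<ge> max M N" for m n
  proof -
    have "s m + t m - (s n + t n) = (s m - s n) + (t m - t n)" by simp
    then have "proj_norm (s m + t m - (s n + t n)) \<le> proj_norm (s m - s n) + proj_norm (t m - t n)"
      by (metis proj_norm_triangle)
    also have "\<dots> < e / 2 + e / 2" using M[of m n] N[of m n] that by (intro add_strict_mono) auto
    finally show ?thesis by simp
  qed
  then show "\<exists>N. \<forall>m\<ge>N. \<forall>n\<ge>N. proj_norm (s m + t m - (s n + t n)) < e" by blast
qed

lemma cauchy_scale: "s \<in> cauchy_seqs \<Longrightarrow> (\<lambda>n. fs_scale c (s n)) \<in> cauchy_seqs"
  by (rule cauchy_map[where K = "cmod c"]) (simp_all add: proj_norm_scale fs.scale_right_diff_distrib)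

lemma cauchy_lact: "s \<in> cauchy_seqs \<Longrightarrow> (\<lambda>n. fs_lact a (s n)) \<in> cauchy_seqs"
  by (rule cauchy_map[where K = "norm a"]) (simp_all add: proj_norm_lact fs_lact_simps)

lemma cauchy_ract: "s \<in> cauchy_seqs \<Longrightarrow> (\<lambda>n. fs_ract (s n) a) \<in> cauchy_seqs"
  by (rule cauchy_map[where K = "norm a"]) (simp_all add: proj_norm_ract fs_ract_simps)

lemma tclass_in [simp]: "s \<in> cauchy_seqs \<Longrightarrow> tclass s \<in> carrier proj_tensor"
  by (simp add: proj_tensor_def tclass_def quotientI)

lemma tensorE:
  assumes "u \<in> carrier proj_tensor"
  obtains s where "s \<in> cauchy_seqs" "u = tclass s"
  using assms by (auto simp: proj_tensor_def tclass_def elim: quotientE)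

lemma tclass_eqI_null:
  assumes "s \<in> cauchy_seqs" "t \<in> cauchy_seqs" "\<And>n. s n - t n \<in> tensor_null"
  shows "tclass s = tclass t"
  using assms by (intro tclass_eqI) (auto simp: proj_norm_null)

lemma trep_props:
  assumes "s \<in> cauchy_seqs"
  shows "trep (tclass s) \<in> cauchy_seqs" "(\<lambda>n. proj_norm (trep (tclass s) n - s n)) \<longlonglongrightarrow> 0"
  using trep_tclass[OF assms] by (auto simp: seq_equiv_def proj_norm_minus_commute)

text \<open>The operations on classes can be computed with arbitrary representing sequences.\<close>

lemma tensor_add:
  assumes "s \<in> cauchy_seqs" "t \<in> cauchy_seqs"
  shows "tclass s \<oplus>\<^bsub>proj_tensor\<^esub> tclass t = tclass (\<lambda>n. s n + t n)"
proof -
  let ?s = "trep (tclass s)" and ?t = "trep (tclass t)"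
  have lim: "(\<lambda>n. proj_norm (?s n - s n) + proj_norm (?t n - t n)) \<longlonglongrightarrow> 0"
    using tendsto_add[OF trep_props(2)[OF assms(1)] trep_props(2)[OF assms(2)]] by simp
  have le: "proj_norm (?s n + ?t n - (s n + t n)) \<le> proj_norm (?s n - s n) + proj_norm (?t n - t n)" for n
    using proj_norm_triangle[of "?s n - s n" "?t n - t n"] by (simp add: algebra_simps)
  have "(\<lambda>n. proj_norm (?s n + ?t n - (s n + t n))) \<longlonglongrightarrow> 0"
    by (rule tendsto_sandwich[OF always_eventually always_eventually tendsto_const lim])
       (simp_all add: proj_norm_nonneg le)
  then have "tclass (\<lambda>n. ?s n + ?t n) = tclass (\<lambda>n. s n + t n)"
    using assms by (intro tclass_eqI cauchy_add trep_props)
  then show ?thesis by (simp add: proj_tensor_def)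
qed

lemma tensor_smult:
  assumes "s \<in> cauchy_seqs"
  shows "c \<odot>\<^bsub>proj_tensor\<^esub> tclass s = tclass (\<lambda>n. fs_scale c (s n))"
  using tclass_map[OF assms, of "fs_scale c" "cmod c"]
  by (simp add: proj_tensor_def proj_norm_scale fs.scale_right_diff_distrib)

lemma tensor_lact:
  assumes "s \<in> cauchy_seqs"
  shows "lact proj_tensor a (tclass s) = tclass (\<lambda>n. fs_lact a (s n))"
  using tclass_map[OF assms, of "fs_lact a" "norm a"]
  by (simp add: proj_tensor_def proj_norm_lact fs_lact_simps)

lemma tensor_ract:
  assumes "s \<in> cauchy_seqs"
  shows "ract proj_tensor (tclass s) a = tclass (\<lambda>n. fs_ract (s n) a)"
  using tclass_map[OF assms, of "\<lambda>u. fs_ract u a" "norm a"]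
  by (simp add: proj_tensor_def proj_norm_ract fs_ract_simps)

lemma tensor_zero: "\<zero>\<^bsub>proj_tensor\<^esub> = tclass (\<lambda>_. 0)"
  by (simp add: proj_tensor_def)

lemma tensor_norm_lim:
  assumes "s \<in> cauchy_seqs"
  shows "(\<lambda>n. proj_norm (s n)) \<longlonglongrightarrow> vnorm proj_tensor (tclass s)"
proof -
  let ?t = "trep (tclass s)"
  have "Cauchy (\<lambda>n. proj_norm (?t n))"
    unfolding Cauchy_def dist_real_def
    using cauchy_seqsD[OF trep_props(1)[OF assms]] order_le_less_trans[OF proj_norm_abs_diff] by meson
  then have "(\<lambda>n. proj_norm (?t n)) \<longlonglongrightarrow> lim (\<lambda>n. proj_norm (?t n))"
    by (simp add: Cauchy_convergent_iff convergent_LIMSEQ_iff)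
  moreover have "(\<lambda>n. proj_norm (s n) - proj_norm (?t n)) \<longlonglongrightarrow> 0"
    by (rule Lim_null_comparison[OF always_eventually trep_props(2)[OF assms]])
       (use proj_norm_abs_diff proj_norm_minus_commute in \<open>metis real_norm_def\<close>)
  ultimately have "(\<lambda>n. (proj_norm (s n) - proj_norm (?t n)) + proj_norm (?t n)) \<longlonglongrightarrow> 0 + lim (\<lambda>n. proj_norm (?t n))"
    by (intro tendsto_add)
  then show ?thesis by (simp add: proj_tensor_def)
qed

lemma diagonal_op_lim:
  assumes "s \<in> cauchy_seqs"
  shows "(\<lambda>n. fs_diag (s n)) \<longlonglongrightarrow> diagonal_op (tclass s)"
proof -
  let ?t = "trep (tclass s)"
  have "Cauchy (\<lambda>n. fs_diag (?t n))"
    unfolding Cauchy_def dist_norm fs_diag_simps(2)[symmetric]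
    using cauchy_seqsD[OF trep_props(1)[OF assms]] order_le_less_trans[OF fs_diag_le] by meson
  then have "(\<lambda>n. fs_diag (?t n)) \<longlonglongrightarrow> diagonal_op (tclass s)"
    by (simp add: diagonal_op_def Cauchy_convergent_iff convergent_LIMSEQ_iff)
  moreover have "(\<lambda>n. fs_diag (s n) - fs_diag (?t n)) \<longlonglongrightarrow> 0"
    by (rule Lim_null_comparison[OF always_eventually trep_props(2)[OF assms]])
       (use fs_diag_le proj_norm_minus_commute fs_diag_simps(2) in metis)
  ultimately have "(\<lambda>n. (fs_diag (s n) - fs_diag (?t n)) + fs_diag (?t n)) \<longlonglongrightarrow> 0 + diagonal_op (tclass s)"
    by (intro tendsto_add)
  then show ?thesis by simp
qed

lemmas tensor_ops = tensor_add tensor_smult tensor_lact tensor_ract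
lemmas cauchy_ops = cauchy_add cauchy_scale cauchy_lact cauchy_ract const_cauchy

lemma normed_space_tensor: "normed_space (proj_tensor :: ('a::complex_banach_algebra, 'a tensor) bimodule)"
proof (rule normed_spaceI)
  fix u :: "'a tensor" assume "u \<in> carrier proj_tensor"
  then obtain s where s: "s \<in> cauchy_seqs" "u = tclass s" by (rule tensorE)
  show "c \<odot>\<^bsub>proj_tensor\<^esub> u \<in> carrier proj_tensor" for c
    using s by (simp add: tensor_ops cauchy_ops)
  show "\<zero>\<^bsub>proj_tensor\<^esub> \<oplus>\<^bsub>proj_tensor\<^esub> u = u" "0 \<odot>\<^bsub>proj_tensor\<^esub> u = \<zero>\<^bsub>proj_tensor\<^esub>" "1 \<odot>\<^bsub>proj_tensor\<^esub> u = u"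
    using s by (simp_all add: tensor_zero tensor_ops cauchy_ops)
  show "(c + d) \<odot>\<^bsub>proj_tensor\<^esub> u = c \<odot>\<^bsub>proj_tensor\<^esub> u \<oplus>\<^bsub>proj_tensor\<^esub> d \<odot>\<^bsub>proj_tensor\<^esub> u"
    "(c * d) \<odot>\<^bsub>proj_tensor\<^esub> u = c \<odot>\<^bsub>proj_tensor\<^esub> (d \<odot>\<^bsub>proj_tensor\<^esub> u)" for c d
    using s by (simp_all add: tensor_ops cauchy_ops fs.scale_left_distrib)
  show "0 \<le> vnorm proj_tensor u"
    using tensor_norm_lim[OF s(1)] s(2) by (auto intro: LIMSEQ_le_const simp: proj_norm_nonneg)
  show "u = \<zero>\<^bsub>proj_tensor\<^esub>" if "vnorm proj_tensor u = 0"
    unfolding s(2) tensor_zero using tensor_norm_lim[OF s(1)] that s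
    by (intro tclass_eqI const_cauchy) simp_all
  show "vnorm proj_tensor (c \<odot>\<^bsub>proj_tensor\<^esub> u) = cmod c * vnorm proj_tensor u" for c
  proof (rule LIMSEQ_unique)
    show "(\<lambda>n. proj_norm (fs_scale c (s n))) \<longlonglongrightarrow> vnorm proj_tensor (c \<odot>\<^bsub>proj_tensor\<^esub> u)"
      using tensor_norm_lim[OF cauchy_scale[OF s(1)]] s by (simp add: tensor_smult)
    show "(\<lambda>n. proj_norm (fs_scale c (s n))) \<longlonglongrightarrow> cmod c * vnorm proj_tensor u"
      unfolding proj_norm_scale s(2) by (intro tendsto_intros tensor_norm_lim s)
  qed
  fix v :: "'a tensor" assume "v \<in> carrier proj_tensor"
  then obtain t where t: "t \<in> cauchy_seqs" "v = tclass t" by (rule tensorE)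
  show "u \<oplus>\<^bsub>proj_tensor\<^esub> v \<in> carrier proj_tensor" "u \<oplus>\<^bsub>proj_tensor\<^esub> v = v \<oplus>\<^bsub>proj_tensor\<^esub> u"
    using s t by (simp_all add: tensor_ops cauchy_ops add.commute)
  show "c \<odot>\<^bsub>proj_tensor\<^esub> (u \<oplus>\<^bsub>proj_tensor\<^esub> v) = c \<odot>\<^bsub>proj_tensor\<^esub> u \<oplus>\<^bsub>proj_tensor\<^esub> c \<odot>\<^bsub>proj_tensor\<^esub> v" for c
    using s t by (simp add: tensor_ops cauchy_ops fs.scale_right_distrib)
  show "vnorm proj_tensor (u \<oplus>\<^bsub>proj_tensor\<^esub> v) \<le> vnorm proj_tensor u + vnorm proj_tensor v"
  proof (rule LIMSEQ_le)
    show "(\<lambda>n. proj_norm (s n + t n)) \<longlonglongrightarrow> vnorm proj_tensor (u \<oplus>\<^bsub>proj_tensor\<^esub> v)"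
      using tensor_norm_lim[OF cauchy_add[OF s(1) t(1)]] s t by (simp add: tensor_add)
    show "(\<lambda>n. proj_norm (s n) + proj_norm (t n)) \<longlonglongrightarrow> vnorm proj_tensor u + vnorm proj_tensor v"
      unfolding s(2) t(2) by (intro tendsto_intros tensor_norm_lim s t)
  qed (use proj_norm_triangle in auto)
  fix w :: "'a tensor" assume "w \<in> carrier proj_tensor"
  then obtain r where r: "r \<in> cauchy_seqs" "w = tclass r" by (rule tensorE)
  show "u \<oplus>\<^bsub>proj_tensor\<^esub> v \<oplus>\<^bsub>proj_tensor\<^esub> w = u \<oplus>\<^bsub>proj_tensor\<^esub> (v \<oplus>\<^bsub>proj_tensor\<^esub> w)"
    using s t r by (simp add: tensor_ops cauchy_ops add.assoc)
next
  show "\<zero>\<^bsub>proj_tensor\<^esub> \<in> carrier (proj_tensor :: ('a, 'a tensor) bimodule)"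
    by (simp add: tensor_zero const_cauchy)
qed

lemma tensor_act:
  assumes "u \<in> carrier proj_tensor"
  shows "lact proj_tensor a u \<in> carrier proj_tensor"
    and "ract proj_tensor u a \<in> carrier proj_tensor"
    and "lact proj_tensor a (c \<odot>\<^bsub>proj_tensor\<^esub> u) = c \<odot>\<^bsub>proj_tensor\<^esub> lact proj_tensor a u"
    and "ract proj_tensor (c \<odot>\<^bsub>proj_tensor\<^esub> u) a = c \<odot>\<^bsub>proj_tensor\<^esub> ract proj_tensor u a"
    and "lact proj_tensor (a + b) u = lact proj_tensor a u \<oplus>\<^bsub>proj_tensor\<^esub> lact proj_tensor b u"
    and "ract proj_tensor u (a + b) = ract proj_tensor u a \<oplus>\<^bsub>proj_tensor\<^esub> ract proj_tensor u b"
    and "lact proj_tensor (scaleC c a) u = c \<odot>\<^bsub>proj_tensor\<^esub> lact proj_tensor a u"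
    and "ract proj_tensor u (scaleC c a) = c \<odot>\<^bsub>proj_tensor\<^esub> ract proj_tensor u a"
    and "lact proj_tensor (a * b) u = lact proj_tensor a (lact proj_tensor b u)"
    and "ract proj_tensor u (a * b) = ract proj_tensor (ract proj_tensor u a) b"
    and "lact proj_tensor a (ract proj_tensor u b) = ract proj_tensor (lact proj_tensor a u) b"
    and "vnorm proj_tensor (lact proj_tensor a u) \<le> norm a * vnorm proj_tensor u"
    and "vnorm proj_tensor (ract proj_tensor u a) \<le> norm a * vnorm proj_tensor u"
proof -
  obtain s where s: "s \<in> cauchy_seqs" "u = tclass s" using assms by (rule tensorE)
  show "lact proj_tensor a u \<in> carrier proj_tensor" "ract proj_tensor u a \<in> carrier proj_tensor"
    "lact proj_tensor a (c \<odot>\<^bsub>proj_tensor\<^esub> u) = c \<odot>\<^bsub>proj_tensor\<^esub> lact proj_tensor a u"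
    "ract proj_tensor (c \<odot>\<^bsub>proj_tensor\<^esub> u) a = c \<odot>\<^bsub>proj_tensor\<^esub> ract proj_tensor u a"
    "lact proj_tensor (a * b) u = lact proj_tensor a (lact proj_tensor b u)"
    "ract proj_tensor u (a * b) = ract proj_tensor (ract proj_tensor u a) b"
    "lact proj_tensor a (ract proj_tensor u b) = ract proj_tensor (lact proj_tensor a u) b"
    using s by (simp_all add: tensor_ops cauchy_ops fs_lact_scale fs_ract_scale fs_lact_mult fs_ract_mult fs_lact_ract)
  show "lact proj_tensor (a + b) u = lact proj_tensor a u \<oplus>\<^bsub>proj_tensor\<^esub> lact proj_tensor b u"
    "ract proj_tensor u (a + b) = ract proj_tensor u a \<oplus>\<^bsub>proj_tensor\<^esub> ract proj_tensor u b"
    "lact proj_tensor (scaleC c a) u = c \<odot>\<^bsub>proj_tensor\<^esub> lact proj_tensor a u"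
    "ract proj_tensor u (scaleC c a) = c \<odot>\<^bsub>proj_tensor\<^esub> ract proj_tensor u a"
    unfolding s(2)
    by (simp_all add: s(1) tensor_ops cauchy_ops)
       (intro tclass_eqI_null cauchy_ops fs_act_add_null fs_act_scaleC_null s(1))+
  show "vnorm proj_tensor (lact proj_tensor a u) \<le> norm a * vnorm proj_tensor u"
  proof (rule LIMSEQ_le)
    show "(\<lambda>n. proj_norm (fs_lact a (s n))) \<longlonglongrightarrow> vnorm proj_tensor (lact proj_tensor a u)"
      using tensor_norm_lim[OF cauchy_lact[OF s(1)]] s by (simp add: tensor_lact)
    show "(\<lambda>n. norm a * proj_norm (s n)) \<longlonglongrightarrow> norm a * vnorm proj_tensor u"
      unfolding s(2) by (intro tendsto_intros tensor_norm_lim s)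
  qed (use proj_norm_lact in blast)
  show "vnorm proj_tensor (ract proj_tensor u a) \<le> norm a * vnorm proj_tensor u"
  proof (rule LIMSEQ_le)
    show "(\<lambda>n. proj_norm (fs_ract (s n) a)) \<longlonglongrightarrow> vnorm proj_tensor (ract proj_tensor u a)"
      using tensor_norm_lim[OF cauchy_ract[OF s(1)]] s by (simp add: tensor_ract)
    show "(\<lambda>n. norm a * proj_norm (s n)) \<longlonglongrightarrow> norm a * vnorm proj_tensor u"
      unfolding s(2) by (intro tendsto_intros tensor_norm_lim s)
  qed (use proj_norm_ract in blast)
qed

lemma tensor_act_add:
  assumes "u \<in> carrier proj_tensor" "v \<in> carrier proj_tensor"
  shows "lact proj_tensor a (u \<oplus>\<^bsub>proj_tensor\<^esub> v) = lact proj_tensor a u \<oplus>\<^bsub>proj_tensor\<^esub> lact proj_tensor a v"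
    and "ract proj_tensor (u \<oplus>\<^bsub>proj_tensor\<^esub> v) a = ract proj_tensor u a \<oplus>\<^bsub>proj_tensor\<^esub> ract proj_tensor v a"
  using assms by (auto elim!: tensorE simp: tensor_ops cauchy_ops fs_lact_add fs_ract_add)

lemma diagonal_op_linear:
  assumes "u \<in> carrier proj_tensor"
  shows "v \<in> carrier proj_tensor \<Longrightarrow> diagonal_op (u \<oplus>\<^bsub>proj_tensor\<^esub> v) = diagonal_op u + diagonal_op v"
    and "diagonal_op (c \<odot>\<^bsub>proj_tensor\<^esub> u) = scaleC c (diagonal_op u)"
    and "diagonal_op (lact proj_tensor a u) = a * diagonal_op u"
    and "diagonal_op (ract proj_tensor u a) = diagonal_op u * a"
    and "norm (diagonal_op u) \<le> vnorm proj_tensor u"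
proof -
  obtain s where s: "s \<in> cauchy_seqs" "u = tclass s" using assms by (rule tensorE)
  note lim = diagonal_op_lim[OF s(1), folded s(2)]
  show "diagonal_op (u \<oplus>\<^bsub>proj_tensor\<^esub> v) = diagonal_op u + diagonal_op v" if v: "v \<in> carrier proj_tensor"
  proof -
    obtain t where t: "t \<in> cauchy_seqs" "v = tclass t" using v by (rule tensorE)
    have "(\<lambda>n. fs_diag (s n + t n)) \<longlonglongrightarrow> diagonal_op u + diagonal_op v"
      unfolding fs_diag_add t(2) by (intro tendsto_intros lim diagonal_op_lim t)
    then show ?thesis
      unfolding s(2) t(2) tensor_add[OF s(1) t(1)] using LIMSEQ_unique[OF diagonal_op_lim[OF cauchy_add[OF s(1) t(1)]]] s(2) t(2) by blast
  qed
  have bl: "bounded_linear (scaleC c :: 'a \<Rightarrow> 'a)"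
  proof (rule bounded_linear_intro[where K = "cmod c"])
    show "scaleC c (r *\<^sub>R x) = r *\<^sub>R scaleC c x" for r and x :: 'a
      by (simp add: scaleC_of_real[symmetric] scaleC_scaleC mult.commute)
  qed (simp_all add: scaleC_add_right norm_scaleC mult.commute)
  have "(\<lambda>n. fs_diag (fs_scale c (s n))) \<longlonglongrightarrow> scaleC c (diagonal_op u)"
    unfolding fs_diag_scale by (rule bounded_linear.tendsto[OF bl lim])
  then show "diagonal_op (c \<odot>\<^bsub>proj_tensor\<^esub> u) = scaleC c (diagonal_op u)"
    unfolding s(2) tensor_smult[OF s(1)] using LIMSEQ_unique[OF diagonal_op_lim[OF cauchy_scale[OF s(1)]]] s(2) by blast
  have "(\<lambda>n. fs_diag (fs_lact a (s n))) \<longlonglongrightarrow> a * diagonal_op u"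
    unfolding fs_diag_lact by (intro tendsto_intros lim)
  then show "diagonal_op (lact proj_tensor a u) = a * diagonal_op u"
    unfolding s(2) tensor_lact[OF s(1)] using LIMSEQ_unique[OF diagonal_op_lim[OF cauchy_lact[OF s(1)]]] s(2) by blast
  have "(\<lambda>n. fs_diag (fs_ract (s n) a)) \<longlonglongrightarrow> diagonal_op u * a"
    unfolding fs_diag_ract by (intro tendsto_intros lim)
  then show "diagonal_op (ract proj_tensor u a) = diagonal_op u * a"
    unfolding s(2) tensor_ract[OF s(1)] using LIMSEQ_unique[OF diagonal_op_lim[OF cauchy_ract[OF s(1)]]] s(2) by blast
  show "norm (diagonal_op u) \<le> vnorm proj_tensor u"
    unfolding s(2)
    by (rule LIMSEQ_le[OF tendsto_norm[OF diagonal_op_lim] tensor_norm_lim]) (use s fs_diag_le in blast)+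
qed

lemma elem_tensor_props:
  "elem_tensor a b \<in> carrier proj_tensor"
  "elem_tensor (a + a') b = elem_tensor a b \<oplus>\<^bsub>proj_tensor\<^esub> elem_tensor a' b"
  "elem_tensor a (b + b') = elem_tensor a b \<oplus>\<^bsub>proj_tensor\<^esub> elem_tensor a b'"
  "elem_tensor (scaleC c a) b = c \<odot>\<^bsub>proj_tensor\<^esub> elem_tensor a b"
  "elem_tensor a (scaleC c b) = c \<odot>\<^bsub>proj_tensor\<^esub> elem_tensor a b"
  "vnorm proj_tensor (elem_tensor a b) \<le> norm a * norm b"
proof -
  show "elem_tensor a b \<in> carrier proj_tensor"
    by (simp add: elem_tensor_def const_cauchy)
  have rel: "pair (a + a') b - (pair a b + pair a' b) \<in> bilinear_relations"
    "pair a (b + b') - (pair a b + pair a b') \<in> bilinear_relations"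
    "pair (scaleC c a) b - fs_scale c (pair a b) \<in> bilinear_relations"
    "pair a (scaleC c b) - fs_scale c (pair a b) \<in> bilinear_relations"
    unfolding bilinear_relations_def diff_diff_eq[symmetric] by blast+
  show "elem_tensor (a + a') b = elem_tensor a b \<oplus>\<^bsub>proj_tensor\<^esub> elem_tensor a' b"
    "elem_tensor a (b + b') = elem_tensor a b \<oplus>\<^bsub>proj_tensor\<^esub> elem_tensor a b'"
    "elem_tensor (scaleC c a) b = c \<odot>\<^bsub>proj_tensor\<^esub> elem_tensor a b"
    "elem_tensor a (scaleC c b) = c \<odot>\<^bsub>proj_tensor\<^esub> elem_tensor a b"
    unfolding elem_tensor_def
    by (simp_all only: tensor_ops const_cauchy)
       (intro tclass_eqI_null cauchy_ops null_base rel)+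
  have "vnorm proj_tensor (elem_tensor a b) = proj_norm (pair a b)"
    using LIMSEQ_unique[OF tensor_norm_lim[OF const_cauchy] tendsto_const] by (simp add: elem_tensor_def)
  also have "\<dots> \<le> norm a * norm b" by (rule proj_norm_le[OF rep_cost_pair])
  finally show "vnorm proj_tensor (elem_tensor a b) \<le> norm a * norm b" .
qed


section \<open>Bimodules over an arbitrary normed space as test modules for amenability\<close>

text \<open>The bimodules in \<^const>\<open>sigma_amenable\<close> consist of sets of functions, whereas the bimodule needed
  below consists of functions.  It is therefore replaced by the isomorphic bimodule of the
  singletons of its elements.  All operations of that copy first send sets outside of its
  carrier to zero.  This makes the distance symmetric and nonnegative for all sets, as
  \<^locale>\<open>Metric_space\<close> requires.  The function \<open>pt\<close> reads off the element that a set stands for.\<close>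

definition pt :: "('x, 'm) nspace_scheme \<Rightarrow> 'x set \<Rightarrow> 'x" where
  "pt X u = (if u \<in> (\<lambda>x. {x}) ` carrier X then the_elem u else \<zero>\<^bsub>X\<^esub>)"

definition singleton_bimodule ::
    "('x, 'm) nspace_scheme \<Rightarrow> ('a \<Rightarrow> 'x \<Rightarrow> 'x) \<Rightarrow> ('x \<Rightarrow> 'a \<Rightarrow> 'x) \<Rightarrow> ('a, 'x set) bimodule" where
  "singleton_bimodule X l r =
     \<lparr>carrier = (\<lambda>x. {x}) ` carrier X, mult = undefined, one = undefined,
      zero = {\<zero>\<^bsub>X\<^esub>},
      add = (\<lambda>u v. {pt X u \<oplus>\<^bsub>X\<^esub> pt X v}),
      smult = (\<lambda>c u. {c \<odot>\<^bsub>X\<^esub> pt X u}),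
      vnorm = (\<lambda>u. vnorm X (pt X u)),
      lact = (\<lambda>a u. {l a (pt X u)}),
      ract = (\<lambda>u a. {r (pt X u) a})\<rparr>"

lemma singleton_bimodule_simps [simp]:
  "carrier (singleton_bimodule X l r) = (\<lambda>x. {x}) ` carrier X"
  "\<zero>\<^bsub>singleton_bimodule X l r\<^esub> = {\<zero>\<^bsub>X\<^esub>}"
  "u \<oplus>\<^bsub>singleton_bimodule X l r\<^esub> v = {pt X u \<oplus>\<^bsub>X\<^esub> pt X v}"
  "c \<odot>\<^bsub>singleton_bimodule X l r\<^esub> u = {c \<odot>\<^bsub>X\<^esub> pt X u}"
  "vnorm (singleton_bimodule X l r) u = vnorm X (pt X u)"
  "lact (singleton_bimodule X l r) a u = {l a (pt X u)}"
  "ract (singleton_bimodule X l r) u a = {r (pt X u) a}"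
  by (simp_all add: singleton_bimodule_def)

lemma pt_singleton [simp]: "x \<in> carrier X \<Longrightarrow> pt X {x} = x"
  by (simp add: pt_def)

lemma pt_in: "normed_space X \<Longrightarrow> pt X u \<in> carrier X"
  using normed_spaceD(2) by (fastforce simp: pt_def)

lemma normed_space_singleton:
  assumes X: "normed_space X"
  shows "normed_space (singleton_bimodule X l r)"
  by (rule normed_spaceI)
     (auto simp: normed_spaceD(1-4,6-12,14,15)[OF X] intro: normed_spaceD(5)[OF X]
       dest: normed_spaceD(13)[OF X, THEN iffD1])

text \<open>The formula holds for all sets, not only for the elements of the carrier: the inverse that
  defines the difference exists uniquely for every set.\<close>

lemma singleton_minus:
  assumes X: "normed_space X"
  shows "u \<ominus>\<^bsub>singleton_bimodule X l r\<^esub> v = {pt X u \<ominus>\<^bsub>X\<^esub> pt X v}"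
proof -
  note D = normed_spaceD[OF X]
  let ?Y = "singleton_bimodule X l r"
  have uniq: "y = (-1) \<odot>\<^bsub>X\<^esub> x" if "x \<in> carrier X" "y \<in> carrier X" "x \<oplus>\<^bsub>X\<^esub> y = \<zero>\<^bsub>X\<^esub>" for x y
  proof -
    have "x \<oplus>\<^bsub>X\<^esub> (-1) \<odot>\<^bsub>X\<^esub> x = \<zero>\<^bsub>X\<^esub>" using D(9)[OF that(1), of 1 "-1"] that(1) by (simp add: D(7,8))
    then show ?thesis using that D(3-6) by metis
  qed
  have neg: "x \<oplus>\<^bsub>X\<^esub> (-1) \<odot>\<^bsub>X\<^esub> x = \<zero>\<^bsub>X\<^esub>" if "x \<in> carrier X" for x
    using D(9)[OF that, of 1 "-1"] that by (simp add: D(7,8))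
  have "\<ominus>\<^bsub>?Y\<^esub> v = {(-1) \<odot>\<^bsub>X\<^esub> pt X v}"
    unfolding a_inv_def m_inv_def
  proof (rule the_equality)
    show "{(-1) \<odot>\<^bsub>X\<^esub> pt X v} \<in> carrier (add_monoid ?Y) \<and>
      v \<otimes>\<^bsub>add_monoid ?Y\<^esub> {(-1) \<odot>\<^bsub>X\<^esub> pt X v} = \<one>\<^bsub>add_monoid ?Y\<^esub> \<and>
      {(-1) \<odot>\<^bsub>X\<^esub> pt X v} \<otimes>\<^bsub>add_monoid ?Y\<^esub> v = \<one>\<^bsub>add_monoid ?Y\<^esub>"
      using pt_in[OF X, of v] neg[of "pt X v"] D(5)[of "(-1) \<odot>\<^bsub>X\<^esub> pt X v" "pt X v"] by (simp add: D(3))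
  next
    fix w assume "w \<in> carrier (add_monoid ?Y) \<and> v \<otimes>\<^bsub>add_monoid ?Y\<^esub> w = \<one>\<^bsub>add_monoid ?Y\<^esub> \<and>
      w \<otimes>\<^bsub>add_monoid ?Y\<^esub> v = \<one>\<^bsub>add_monoid ?Y\<^esub>"
    then obtain y where "y \<in> carrier X" "w = {y}" "pt X v \<oplus>\<^bsub>X\<^esub> pt X w = \<zero>\<^bsub>X\<^esub>" by auto
    then show "w = {(-1) \<odot>\<^bsub>X\<^esub> pt X v}" using uniq[OF pt_in[OF X]] by simp
  qed
  then show ?thesis
    using pt_in[OF X] by (simp add: a_minus_def[of ?Y] D(3,16))
qed

lemma banach_space_singleton:
  assumes X: "normed_space X" and C: "seq_complete X"
  shows "banach_space (singleton_bimodule X l r)"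
proof -
  note D = normed_spaceD[OF X]
  let ?Y = "singleton_bimodule X l r"
  let ?d = "\<lambda>u v. vnorm ?Y (u \<ominus>\<^bsub>?Y\<^esub> v)"
  have d: "?d u v = vnorm X (pt X u \<ominus>\<^bsub>X\<^esub> pt X v)" for u v
    using pt_in[OF X] by (simp add: singleton_minus[OF X] D(1,3,16))
  have ms: "Metric_space (carrier ?Y) ?d"
  proof
    fix u v w
    show "0 \<le> ?d u v" unfolding d using pt_in[OF X] by (simp add: D(1,3,12,16))
    show "?d u v = ?d v u" unfolding d by (intro normed_space_diff_commute X pt_in)
    show "?d u w \<le> ?d u v + ?d v w" unfolding d by (intro normed_space_dist_triangle X pt_in)
    show "?d u v = 0 \<longleftrightarrow> u = v" if "u \<in> carrier ?Y" "v \<in> carrier ?Y"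
    proof
      assume "?d u v = 0"
      then have "pt X u = pt X v"
        unfolding d by (intro normed_space_dist_eq_0[OF X] pt_in[OF X])
      then show "u = v" using that by auto
    next
      assume "u = v"
      have "x \<ominus>\<^bsub>X\<^esub> x = \<zero>\<^bsub>X\<^esub>" if "x \<in> carrier X" for x
        using D(9)[OF that, of 1 "-1"] that by (simp add: D(7,8,16))
      then show "?d u v = 0"
        unfolding d \<open>u = v\<close> using pt_in[OF X, of v] D(2,13) by metis
    qed
  qed
  have "Metric_space.mcomplete (carrier ?Y) ?d"
    unfolding Metric_space.mcomplete_def[OF ms]
  proof (intro allI impI)
    fix s assume s: "Metric_space.MCauchy (carrier ?Y) ?d s"
    then have range: "range s \<subseteq> carrier ?Y"
      and cauchy: "\<And>\<epsilon>. \<epsilon> > 0 \<Longrightarrow> \<exists>N. \<forall>n n'. N \<le> n \<longrightarrow> N \<le> n' \<longrightarrow> vnorm X (pt X (s n) \<ominus>\<^bsub>X\<^esub> pt X (s n')) < \<epsilon>"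
      unfolding Metric_space.MCauchy_def[OF ms] unfolding d by blast+
    obtain l where l: "l \<in> carrier X" "(\<lambda>n. vnorm X (pt X (s n) \<ominus>\<^bsub>X\<^esub> l)) \<longlonglongrightarrow> 0"
    proof -
      have "\<forall>\<epsilon>>0. \<exists>N. \<forall>m\<ge>N. \<forall>n\<ge>N. vnorm X (pt X (s m) \<ominus>\<^bsub>X\<^esub> pt X (s n)) < \<epsilon>"
        using cauchy by blast
      then show ?thesis
        using C[unfolded seq_complete_def, THEN spec[of _ "\<lambda>n. pt X (s n)"]] pt_in[OF X] that by blast
    qed
    have "limitin (Metric_space.mtopology (carrier ?Y) ?d) s {l} sequentially"
      unfolding Metric_space.limitin_metric[OF ms] unfolding d
    proof (intro conjI allI impI)
      show "{l} \<in> carrier ?Y" using l by simp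
      fix \<epsilon> :: real assume "\<epsilon> > 0"
      with l(2) have "\<forall>\<^sub>F n in sequentially. vnorm X (pt X (s n) \<ominus>\<^bsub>X\<^esub> l) < \<epsilon>"
        by (rule order_tendstoD(2))
      then show "\<forall>\<^sub>F n in sequentially. s n \<in> carrier ?Y \<and> vnorm X (pt X (s n) \<ominus>\<^bsub>X\<^esub> pt X {l}) < \<epsilon>"
        by (rule eventually_mono) (use range l(1) in auto)
    qed
    then show "\<exists>x. limitin (Metric_space.mtopology (carrier ?Y) ?d) s x sequentially" ..
  qed
  then show ?thesis
    unfolding banach_space_def using normed_space_singleton[OF X] by blast
qed

text \<open>A Banach bimodule, presented as a complete normed space \<open>X\<close> with a left action \<open>l\<close> and a right
  action \<open>r\<close>.  If \<open>X\<close> is the underlying space of a bimodule record, these actions may differ from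
  the ones in the record.\<close>

locale banach_actions =
  fixes X :: "('x, 'm) nspace_scheme" (structure)
    and l :: "'a::complex_banach_algebra \<Rightarrow> 'x \<Rightarrow> 'x"
    and r :: "'x \<Rightarrow> 'a \<Rightarrow> 'x"
  assumes normed: "normed_space X" and complete: "seq_complete X"
    and closed: "x \<in> carrier X \<Longrightarrow> l a x \<in> carrier X" "x \<in> carrier X \<Longrightarrow> r x a \<in> carrier X"
    and add: "x \<in> carrier X \<Longrightarrow> y \<in> carrier X \<Longrightarrow> l a (x \<oplus> y) = l a x \<oplus> l a y"
      "x \<in> carrier X \<Longrightarrow> y \<in> carrier X \<Longrightarrow> r (x \<oplus> y) a = r x a \<oplus> r y a"
    and smult: "x \<in> carrier X \<Longrightarrow> l a (c \<odot> x) = c \<odot> l a x"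
      "x \<in> carrier X \<Longrightarrow> r (c \<odot> x) a = c \<odot> r x a"
    and act_add: "x \<in> carrier X \<Longrightarrow> l (a + b) x = l a x \<oplus> l b x"
      "x \<in> carrier X \<Longrightarrow> r x (a + b) = r x a \<oplus> r x b"
    and act_scaleC: "x \<in> carrier X \<Longrightarrow> l (scaleC c a) x = c \<odot> l a x"
      "x \<in> carrier X \<Longrightarrow> r x (scaleC c a) = c \<odot> r x a"
    and act_mult: "x \<in> carrier X \<Longrightarrow> l (a * b) x = l a (l b x)"
      "x \<in> carrier X \<Longrightarrow> r x (a * b) = r (r x a) b"
      "x \<in> carrier X \<Longrightarrow> l a (r x b) = r (l a x) b"
    and bounded: "\<exists>K. \<forall>x\<in>carrier X. \<forall>a. vnorm X (l a x) \<le> K * norm a * vnorm X x \<and>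
      vnorm X (r x a) \<le> K * norm a * vnorm X x"
begin

lemma banach_bimodule_singleton: "banach_bimodule (singleton_bimodule X l r)"
proof -
  let ?Y = "singleton_bimodule X l r"
  note D = normed_spaceD[OF normed]
  obtain K where K: "\<And>x a. x \<in> carrier X \<Longrightarrow> vnorm X (l a x) \<le> K * norm a * vnorm X x"
    "\<And>x a. x \<in> carrier X \<Longrightarrow> vnorm X (r x a) \<le> K * norm a * vnorm X x"
    using bounded by blast
  have "bounded_linear_map ?Y ?Y (lact ?Y a)" "bounded_linear_map ?Y ?Y (\<lambda>u. ract ?Y u a)" for a
    unfolding bounded_linear_map_def
    by (auto simp: D(1,3) closed add smult K intro!: exI[of _ "K * norm a"])
  moreover have "\<exists>K. \<forall>u\<in>carrier ?Y. \<forall>a. vnorm ?Y (lact ?Y a u) \<le> K * norm a * vnorm ?Y u \<and>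
      vnorm ?Y (ract ?Y u a) \<le> K * norm a * vnorm ?Y u"
    by (auto simp: closed K intro!: exI[of _ K])
  ultimately show ?thesis
    unfolding banach_bimodule_def
    by (intro conjI banach_space_singleton[OF normed complete])
       (auto simp: closed act_add act_scaleC act_mult)
qed

end

lemma carrier_alg_bimodule [simp]: "carrier alg_bimodule = UNIV"
  and alg_bimodule_simps: "\<zero>\<^bsub>alg_bimodule\<^esub> = 0" "a \<oplus>\<^bsub>alg_bimodule\<^esub> b = a + b"
    "c \<odot>\<^bsub>alg_bimodule\<^esub> a = scaleC c a" "vnorm alg_bimodule a = norm a"
    "lact alg_bimodule a b = a * b" "ract alg_bimodule b a = b * a"
  by (simp_all add: alg_bimodule_def)

lemma normed_space_alg: "normed_space alg_bimodule"
  by (rule normed_spaceI)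
     (simp_all add: alg_bimodule_simps scaleC_add_left scaleC_add_right scaleC_scaleC norm_scaleC
        norm_triangle_ineq add_ac)

lemma dual_act_in:
  assumes X: "normed_space X" and f: "f \<in> carrier (dual X)"
  shows "bounded_linear_map X X (\<lambda>x. ract X x a) \<Longrightarrow> lact (dual X) a f \<in> carrier (dual X)"
    and "bounded_linear_map X X (lact X a) \<Longrightarrow> ract (dual X) f a \<in> carrier (dual X)"
  using dual_map_bounded[OF X X, of "\<lambda>x. ract X x a"] dual_map_bounded[OF X X, of "lact X a"] f
  by (simp_all add: bounded_linear_map_def dual_map_def dual_simps)

text \<open>Amenability applied to a derivation into the dual of a Banach bimodule whose elements are
  functionals on the tensor product; the module operations of the dual are written out.\<close>

lemma sigma_amenable_inner:
  fixes \<sigma> :: "'a::complex_banach_algebra \<Rightarrow> 'a" and X :: "('a, 'a tensor \<Rightarrow> complex) bimodule"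
  assumes amenable: "sigma_amenable \<sigma>" and actions: "banach_actions X l r"
    and D: "bounded_linear_map alg_bimodule (dual X) D"
    and derivation: "\<And>a b x. x \<in> carrier X \<Longrightarrow> D (a * b) x = D b (r x (\<sigma> a)) + D a (l (\<sigma> b) x)"
  shows "\<exists>N\<in>carrier (dual X). \<forall>a. \<forall>x\<in>carrier X. D a x = N (r x (\<sigma> a)) - N (l (\<sigma> a) x)"
proof -
  interpret banach_actions X l r by (rule actions)
  note X = normed_spaceD[OF normed]
  let ?Y = "singleton_bimodule X l r"
  have Y: "normed_space ?Y" by (rule normed_space_singleton[OF normed])
  have D_in: "D a \<in> carrier (dual X)" for a
    using D by (simp add: bounded_linear_map_def)
  have D_linear: "D (a + b) = D a \<oplus>\<^bsub>dual X\<^esub> D b" "D (scaleC c a) = c \<odot>\<^bsub>dual X\<^esub> D a" for a b c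
    using D by (simp_all add: bounded_linear_map_def alg_bimodule_simps)
  obtain K where K: "\<And>a. vnorm (dual X) (D a) \<le> K * norm a"
    using D by (auto simp: bounded_linear_map_def alg_bimodule_simps)
  define \<delta> where "\<delta> a = (\<lambda>u\<in>carrier ?Y. D a (pt X u))" for a
  have \<delta>: "\<delta> a \<in> carrier (dual ?Y)" for a
    unfolding \<delta>_def
    by (rule restrict_functionalI[OF Y, where K = "vnorm (dual X) (D a)"])
       (auto simp: X(1,3) functionalD[OF D_in] functional_le[OF normed D_in])
  have "bounded_linear_map alg_bimodule (dual ?Y) \<delta>"
    unfolding bounded_linear_map_def
  proof (intro conjI ballI allI exI)
    fix a :: 'a
    have "vnorm (dual ?Y) (\<delta> a) \<le> vnorm (dual X) (D a)"
      using dual_norm_nonneg[OF normed D_in] functional_le[OF normed D_in]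
      by (intro dual_norm_leI[OF Y]) (auto simp: \<delta>_def)
    then show "vnorm (dual ?Y) (\<delta> a) \<le> K * vnorm alg_bimodule a"
      using K[of a] by (simp add: alg_bimodule_simps)
  qed (rule \<delta>, auto simp: \<delta>_def dual_simps alg_bimodule_simps D_linear intro!: restrict_ext)
  moreover have "\<delta> (a * b) = lact (dual ?Y) (\<sigma> a) (\<delta> b) \<oplus>\<^bsub>dual ?Y\<^esub> ract (dual ?Y) (\<delta> a) (\<sigma> b)" for a b
    by (auto simp: \<delta>_def dual_simps derivation closed intro!: restrict_ext)
  ultimately have "sigma_derivation \<sigma> (dual ?Y) \<delta>"
    unfolding sigma_derivation_def by blast
  then have "sigma_inner \<sigma> (dual ?Y) \<delta>"
    using amenable banach_bimodule_singleton unfolding sigma_amenable_def by blast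
  then obtain n where n: "n \<in> carrier (dual ?Y)"
    "\<And>a. \<delta> a = lact (dual ?Y) (\<sigma> a) n \<ominus>\<^bsub>dual ?Y\<^esub> ract (dual ?Y) n (\<sigma> a)"
    unfolding sigma_inner_def by blast
  have act: "lact (dual ?Y) a n \<in> carrier (dual ?Y)" "ract (dual ?Y) n a \<in> carrier (dual ?Y)" for a
    using banach_bimodule_singleton unfolding banach_bimodule_def
    by (auto intro!: dual_act_in[OF Y n(1)])
  let ?N = "\<lambda>x\<in>carrier X. n {x}"
  have "?N \<in> carrier (dual X)"
  proof (rule restrict_functionalI[OF normed])
    show "n {x \<oplus>\<^bsub>X\<^esub> y} = n {x} + n {y}" if "x \<in> carrier X" "y \<in> carrier X" for x y
      using functionalD(2)[OF n(1), of "{x}" "{y}"] that by simp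
    show "n {c \<odot>\<^bsub>X\<^esub> x} = c * n {x}" if "x \<in> carrier X" for c x
      using functionalD(3)[OF n(1), of "{x}" c] that by simp
    show "cmod (n {x}) \<le> vnorm (dual ?Y) n * vnorm X x" if "x \<in> carrier X" for x
      using functional_le[OF Y n(1), of "{x}"] that by simp
  qed
  moreover have "D a x = ?N (r x (\<sigma> a)) - ?N (l (\<sigma> a) x)" if x: "x \<in> carrier X" for a x
  proof -
    have "D a x = \<delta> a {x}" using x by (simp add: \<delta>_def)
    also have "\<dots> = n {r x (\<sigma> a)} - n {l (\<sigma> a) x}"
      unfolding n(2) using x by (subst dual_minus_apply[OF Y act]) (auto simp: dual_simps)
    finally show ?thesis using x by (simp add: closed)
  qed
  ultimately show ?thesis by blast
qed


section \<open>The twisted bimodule of functionals on the tensor product\<close>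

lemma elem_tensor_functional_le:
  assumes f: "f \<in> carrier (dual (proj_tensor :: ('a::complex_banach_algebra, 'a tensor) bimodule))"
  shows "cmod (f (elem_tensor a b)) \<le> vnorm (dual proj_tensor) f * norm a * norm b"
proof -
  have "cmod (f (elem_tensor a b)) \<le> vnorm (dual proj_tensor) f * vnorm proj_tensor (elem_tensor a b)"
    by (rule functional_le[OF normed_space_tensor f elem_tensor_props(1)])
  also have "\<dots> \<le> vnorm (dual proj_tensor) f * (norm a * norm b)"
    by (intro mult_left_mono elem_tensor_props dual_norm_nonneg[OF normed_space_tensor f])
  finally show ?thesis by (simp add: mult.assoc)
qed

lemma bounded_bilinear_elem_tensor:
  fixes f :: "'a::complex_banach_algebra tensor \<Rightarrow> complex"
  assumes f: "f \<in> carrier (dual (proj_tensor :: ('a, 'a tensor) bimodule))"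
  shows "bounded_bilinear (\<lambda>a b. f (elem_tensor a b))"
proof
  fix a a' b b' :: 'a and c :: real
  note F = functionalD[OF f]
  show "f (elem_tensor (a + a') b) = f (elem_tensor a b) + f (elem_tensor a' b)"
    "f (elem_tensor a (b + b')) = f (elem_tensor a b) + f (elem_tensor a b')"
    by (simp_all add: elem_tensor_props F)
  show "f (elem_tensor (c *\<^sub>R a) b) = c *\<^sub>R f (elem_tensor a b)"
    "f (elem_tensor a (c *\<^sub>R b)) = c *\<^sub>R f (elem_tensor a b)"
    by (simp_all add: scaleC_of_real[symmetric] elem_tensor_props F scaleR_conv_of_real)
  show "\<exists>K. \<forall>a b. norm (f (elem_tensor a b)) \<le> norm a * norm b * K"
    using elem_tensor_functional_le[OF f] by (auto simp: mult_ac intro!: exI[of _ "vnorm (dual proj_tensor) f"])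
qed

text \<open>The left action of the twisted bimodule.  The ordinary left action sends \<open>f\<close> to
  \<open>x \<mapsto> f (x \<cdot> a)\<close>; the term that is subtracted makes the twisted action of \<open>a\<close> kill every
  functional of the form \<open>g \<circ> \<pi>\<close>, because \<open>\<pi> (x \<cdot> a) = \<pi> x * a = \<pi> (\<pi> x \<otimes> a)\<close>.\<close>

definition twisted_lact :: "'a::complex_banach_algebra \<Rightarrow> ('a tensor \<Rightarrow> complex) \<Rightarrow> 'a tensor \<Rightarrow> complex" where
  "twisted_lact a f =
     (\<lambda>x\<in>carrier proj_tensor. f (ract proj_tensor x a) - f (elem_tensor (diagonal_op x) a))"

lemma twisted_lact_le:
  assumes f: "f \<in> carrier (dual (proj_tensor :: ('a::complex_banach_algebra, 'a tensor) bimodule))"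
    and x: "x \<in> carrier proj_tensor"
  shows "cmod (f (ract proj_tensor x a) - f (elem_tensor (diagonal_op x) a))
    \<le> 2 * norm a * vnorm (dual proj_tensor) f * vnorm proj_tensor x"
proof -
  note f0 = dual_norm_nonneg[OF normed_space_tensor f]
  have "cmod (f (ract proj_tensor x a)) \<le> vnorm (dual proj_tensor) f * (norm a * vnorm proj_tensor x)"
    using functional_le[OF normed_space_tensor f tensor_act(2)[OF x]]
      mult_left_mono[OF tensor_act(13)[OF x] f0] by (meson order_trans)
  moreover have "cmod (f (elem_tensor (diagonal_op x) a)) \<le> vnorm (dual proj_tensor) f * vnorm proj_tensor x * norm a"
    by (rule order_trans[OF elem_tensor_functional_le[OF f]])
       (intro mult_right_mono mult_left_mono diagonal_op_linear(5) x f0, simp)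
  ultimately show ?thesis
    using norm_triangle_ineq4[of "f (ract proj_tensor x a)" "f (elem_tensor (diagonal_op x) a)"]
    by (simp add: mult_ac)
qed

lemma twisted_lact_in:
  assumes f: "f \<in> carrier (dual (proj_tensor :: ('a::complex_banach_algebra, 'a tensor) bimodule))"
  shows "twisted_lact a f \<in> carrier (dual proj_tensor)"
  unfolding twisted_lact_def
  by (rule restrict_functionalI[OF normed_space_tensor _ _ twisted_lact_le[OF f]])
     (simp_all add: tensor_act tensor_act_add diagonal_op_linear elem_tensor_props functionalD[OF f]
       algebra_simps)

lemma tensor_dual_act_in:
  assumes f: "f \<in> carrier (dual (proj_tensor :: ('a::complex_banach_algebra, 'a tensor) bimodule))"
  shows "lact (dual proj_tensor) a f \<in> carrier (dual proj_tensor)"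
    and "ract (dual proj_tensor) f a \<in> carrier (dual proj_tensor)"
  by (auto intro!: dual_act_in[OF normed_space_tensor f] exI[of _ "norm a"]
      simp: bounded_linear_map_def tensor_act tensor_act_add)

lemma tensor_dual_ract_norm:
  assumes f: "f \<in> carrier (dual (proj_tensor :: ('a::complex_banach_algebra, 'a tensor) bimodule))"
  shows "vnorm (dual proj_tensor) (ract (dual proj_tensor) f a) \<le> norm a * vnorm (dual proj_tensor) f"
proof (rule dual_norm_leI[OF normed_space_tensor])
  note f0 = dual_norm_nonneg[OF normed_space_tensor f]
  show "0 \<le> norm a * vnorm (dual proj_tensor) f" using f0 by simp
  fix x :: "'a tensor" assume x: "x \<in> carrier proj_tensor"
  have "cmod (f (lact proj_tensor a x)) \<le> vnorm (dual proj_tensor) f * (norm a * vnorm proj_tensor x)"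
    using functional_le[OF normed_space_tensor f tensor_act(1)[OF x]]
      mult_left_mono[OF tensor_act(12)[OF x] f0] by (meson order_trans)
  then show "cmod (ract (dual proj_tensor) f a x) \<le> norm a * vnorm (dual proj_tensor) f * vnorm proj_tensor x"
    using x by (simp add: dual_simps mult_ac)
qed

text \<open>The twisted left action is associative: of the four terms of \<open>(a \<bullet> (b \<bullet> f)) x\<close> the two terms
  \<open>- f (\<pi> (x \<cdot> a) \<otimes> b)\<close> and \<open>f (\<pi> (\<pi> x \<otimes> a) \<otimes> b)\<close> cancel, and the others form \<open>(a * b \<bullet> f) x\<close>.\<close>

lemma banach_actions_twisted:
  "banach_actions (dual (proj_tensor :: ('a::complex_banach_algebra, 'a tensor) bimodule))
     twisted_lact (ract (dual proj_tensor))"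
proof
  let ?V = "dual (proj_tensor :: ('a, 'a tensor) bimodule)"
  note T = normed_spaceD(1,3)[OF normed_space_tensor]
  show "normed_space ?V" by (rule normed_space_dual[OF normed_space_tensor])
  show "seq_complete ?V" by (rule seq_complete_dual[OF normed_space_tensor])
  fix f assume f: "f \<in> carrier ?V"
  note F = functionalD[OF f]
  note facts = T tensor_act tensor_act_add diagonal_op_linear elem_tensor_props F diagonal_op_elem
    lact_elem ract_elem
  show "twisted_lact a f \<in> carrier ?V" for a by (rule twisted_lact_in[OF f])
  show "ract ?V f a \<in> carrier ?V" for a by (rule tensor_dual_act_in(2)[OF f])
  show "twisted_lact a (c \<odot>\<^bsub>?V\<^esub> f) = c \<odot>\<^bsub>?V\<^esub> twisted_lact a f" "ract ?V (c \<odot>\<^bsub>?V\<^esub> f) a = c \<odot>\<^bsub>?V\<^esub> ract ?V f a" for a c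
    by (auto simp: twisted_lact_def dual_simps facts algebra_simps intro!: restrict_ext)
  show "twisted_lact (a + b) f = twisted_lact a f \<oplus>\<^bsub>?V\<^esub> twisted_lact b f"
    "ract ?V f (a + b) = ract ?V f a \<oplus>\<^bsub>?V\<^esub> ract ?V f b" for a b
    by (auto simp: twisted_lact_def dual_simps facts intro!: restrict_ext)
  show "twisted_lact (scaleC c a) f = c \<odot>\<^bsub>?V\<^esub> twisted_lact a f"
    "ract ?V f (scaleC c a) = c \<odot>\<^bsub>?V\<^esub> ract ?V f a" for a c
    by (auto simp: twisted_lact_def dual_simps facts algebra_simps intro!: restrict_ext)
  show "twisted_lact (a * b) f = twisted_lact a (twisted_lact b f)"
    "ract ?V f (a * b) = ract ?V (ract ?V f a) b"
    "twisted_lact a (ract ?V f b) = ract ?V (twisted_lact a f) b" for a b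
    by (auto simp: twisted_lact_def dual_simps facts mult.assoc intro!: restrict_ext)
  fix g assume g: "g \<in> carrier ?V"
  show "twisted_lact a (f \<oplus>\<^bsub>?V\<^esub> g) = twisted_lact a f \<oplus>\<^bsub>?V\<^esub> twisted_lact a g"
    "ract ?V (f \<oplus>\<^bsub>?V\<^esub> g) a = ract ?V f a \<oplus>\<^bsub>?V\<^esub> ract ?V g a" for a
    by (auto simp: twisted_lact_def dual_simps facts intro!: restrict_ext)
next
  let ?V = "dual (proj_tensor :: ('a, 'a tensor) bimodule)"
  have "vnorm ?V (twisted_lact a f) \<le> 2 * norm a * vnorm ?V f" if f: "f \<in> carrier ?V" for f a
    using twisted_lact_le[OF f] dual_norm_nonneg[OF normed_space_tensor f]
    by (intro dual_norm_leI[OF normed_space_tensor]) (auto simp: twisted_lact_def)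
  moreover have "vnorm ?V (ract ?V f a) \<le> 2 * norm a * vnorm ?V f" if f: "f \<in> carrier ?V" for f a
  proof -
    have "0 \<le> norm a * vnorm ?V f"
      using dual_norm_nonneg[OF normed_space_tensor f] by simp
    then show ?thesis using tensor_dual_ract_norm[OF f, of a] by simp
  qed
  ultimately show "\<exists>K. \<forall>f\<in>carrier ?V. \<forall>a. vnorm ?V (twisted_lact a f) \<le> K * norm a * vnorm ?V f \<and>
      vnorm ?V (ract ?V f a) \<le> K * norm a * vnorm ?V f"
    by blast
qed

lemma alg_hom_bounded:
  assumes "alg_hom \<sigma>"
  shows "\<exists>S\<ge>0. \<forall>a. norm (\<sigma> a) \<le> S * norm a"
proof -
  have add: "\<sigma> (a + b) = \<sigma> a + \<sigma> b" and scale: "\<sigma> (scaleC c a) = scaleC c (\<sigma> a)" for a b c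
    using assms by (auto simp: alg_hom_def)
  have scaleR: "\<sigma> (t *\<^sub>R a) = t *\<^sub>R \<sigma> a" for t a
    using scale[of "of_real t" a] by (simp add: scaleC_of_real)
  have zero: "\<sigma> 0 = 0" using scaleR[of 0 0] by simp
  have "isCont \<sigma> 0" using assms by (simp add: alg_hom_def continuous_on_eq_continuous_at)
  then obtain d where d: "d > 0" "\<And>a. norm a < d \<Longrightarrow> norm (\<sigma> a) < 1"
    unfolding continuous_at_eps_delta dist_norm using zero by (metis diff_zero zero_less_one)
  have "norm (\<sigma> a) \<le> 2 / d * norm a" for a
  proof (cases "a = 0")
    case True
    then show ?thesis by (simp add: zero)
  next
    case False
    let ?t = "d / (2 * norm a)"
    have t: "?t > 0" using False d(1) by simp
    have "norm (?t *\<^sub>R a) < d" using False d(1) by simp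
    then have "norm (\<sigma> (?t *\<^sub>R a)) < 1" by (rule d(2))
    then have "?t * norm (\<sigma> a) < 1" using t d(1) by (simp add: scaleR)
    then show ?thesis using False d(1) by (simp add: field_simps)
  qed
  then show ?thesis using d(1) by (intro exI[of _ "2 / d"]) auto
qed

section \<open>Limits along the approximate identity\<close>

text \<open>An ultrafilter refining a bounded approximate identity, with a bound \<open>K\<close> for the latter.\<close>

locale approx_identity_ultrafilter =
  fixes U :: "'a::complex_banach_algebra filter" and K :: real
  assumes ultra: "ultrafilter U"
    and bounded: "\<forall>\<^sub>F e in U. norm e \<le> K"
    and right: "((\<lambda>e. a * e) \<longlongrightarrow> a) U"
    and left: "((\<lambda>e. e * a) \<longlongrightarrow> a) U"
begin

abbreviation "T \<equiv> (proj_tensor :: ('a, 'a tensor) bimodule)"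
abbreviation "V \<equiv> dual T"

lemma not_bot: "U \<noteq> bot" using ultra by (simp add: ultrafilter_def)

lemma K_nonneg: "0 \<le> K"
  using eventually_happens'[OF not_bot bounded] norm_ge_zero order_trans by blast

lemma tendsto_unique_Lim: "(\<phi> \<longlongrightarrow> l) U \<Longrightarrow> Lim U \<phi> = (l :: complex)"
  by (rule tendsto_Lim[OF not_bot])

text \<open>For a functional \<open>f\<close> on the tensor product, the limits of \<open>f (b \<otimes> e)\<close> and of \<open>f (e \<otimes> b)\<close> along
  the ultrafilter, as functions of \<open>b\<close>.\<close>

definition right_limit :: "('a tensor \<Rightarrow> complex) \<Rightarrow> 'a \<Rightarrow> complex" where
  "right_limit f b = Lim U (\<lambda>e. f (elem_tensor b e))"

definition left_limit :: "('a tensor \<Rightarrow> complex) \<Rightarrow> 'a \<Rightarrow> complex" where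
  "left_limit f b = Lim U (\<lambda>e. f (elem_tensor e b))"

lemma
  assumes f: "f \<in> carrier V"
  shows right_limit: "((\<lambda>e. f (elem_tensor b e)) \<longlongrightarrow> right_limit f b) U"
    and left_limit: "((\<lambda>e. f (elem_tensor e b)) \<longlongrightarrow> left_limit f b) U"
    and right_limit_le: "cmod (right_limit f b) \<le> K * vnorm V f * norm b"
    and left_limit_le: "cmod (left_limit f b) \<le> K * vnorm V f * norm b"
proof -
  note f0 = dual_norm_nonneg[OF normed_space_tensor f]
  have r: "\<forall>\<^sub>F e in U. f (elem_tensor b e) \<in> cball 0 (K * vnorm V f * norm b)"
    using bounded
  proof (rule eventually_mono)
    fix e :: 'a assume "norm e \<le> K"
    then have "vnorm V f * norm b * norm e \<le> vnorm V f * norm b * K"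
      using f0 by (intro mult_left_mono) auto
    with elem_tensor_functional_le[OF f, of b e]
    show "f (elem_tensor b e) \<in> cball 0 (K * vnorm V f * norm b)" by (simp add: mult_ac)
  qed
  have l: "\<forall>\<^sub>F e in U. f (elem_tensor e b) \<in> cball 0 (K * vnorm V f * norm b)"
    using bounded
  proof (rule eventually_mono)
    fix e :: 'a assume "norm e \<le> K"
    then have "vnorm V f * norm b * norm e \<le> vnorm V f * norm b * K"
      using f0 by (intro mult_left_mono) auto
    with elem_tensor_functional_le[OF f, of e b]
    show "f (elem_tensor e b) \<in> cball 0 (K * vnorm V f * norm b)" by (simp add: mult_ac)
  qed
  show r': "((\<lambda>e. f (elem_tensor b e)) \<longlongrightarrow> right_limit f b) U"
    unfolding right_limit_def by (rule ultrafilter_tendsto_Lim[OF ultra bounded_cball r])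
  show l': "((\<lambda>e. f (elem_tensor e b)) \<longlongrightarrow> left_limit f b) U"
    unfolding left_limit_def by (rule ultrafilter_tendsto_Lim[OF ultra bounded_cball l])
  show "cmod (right_limit f b) \<le> K * vnorm V f * norm b"
    using Lim_in_closed_set[OF closed_cball r not_bot r'] by simp
  show "cmod (left_limit f b) \<le> K * vnorm V f * norm b"
    using Lim_in_closed_set[OF closed_cball l not_bot l'] by simp
qed

lemma right_limit_linear:
  assumes f: "f \<in> carrier V"
  shows "right_limit f (a + b) = right_limit f a + right_limit f b"
    and "right_limit f (scaleC c a) = c * right_limit f a"
    and "g \<in> carrier V \<Longrightarrow> right_limit (f \<oplus>\<^bsub>V\<^esub> g) a = right_limit f a + right_limit g a"
    and "right_limit (c \<odot>\<^bsub>V\<^esub> f) a = c * right_limit f a"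
    and "right_limit (ract V f b) a = right_limit f (b * a)"
    and "right_limit (lact V b f) a = f (elem_tensor a b)"
proof -
  note lim = right_limit[OF f]
  note F = functionalD[OF f] elem_tensor_props
  show "right_limit f (a + b) = right_limit f a + right_limit f b"
    unfolding right_limit_def[of f "a + b"]
    by (rule tendsto_unique_Lim) (simp add: F tendsto_add lim)
  show "right_limit f (scaleC c a) = c * right_limit f a"
    unfolding right_limit_def[of f "scaleC c a"]
    by (rule tendsto_unique_Lim) (simp add: F tendsto_mult_left lim)
  show "right_limit (f \<oplus>\<^bsub>V\<^esub> g) a = right_limit f a + right_limit g a" if "g \<in> carrier V"
    unfolding right_limit_def[of "f \<oplus>\<^bsub>V\<^esub> g"]
    by (rule tendsto_unique_Lim) (simp add: dual_simps F tendsto_add lim right_limit[OF that])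
  show "right_limit (c \<odot>\<^bsub>V\<^esub> f) a = c * right_limit f a"
    unfolding right_limit_def[of "c \<odot>\<^bsub>V\<^esub> f"]
    by (rule tendsto_unique_Lim) (simp add: dual_simps F tendsto_mult_left lim)
  show "right_limit (ract V f b) a = right_limit f (b * a)"
    unfolding right_limit_def by (simp add: dual_simps F lact_elem)
  have "((\<lambda>e. f (elem_tensor a (e * b))) \<longlongrightarrow> f (elem_tensor a b)) U"
    by (rule bounded_bilinear.tendsto[OF bounded_bilinear_elem_tensor[OF f] tendsto_const left])
  then show "right_limit (lact V b f) a = f (elem_tensor a b)"
    unfolding right_limit_def by (intro tendsto_unique_Lim) (simp add: dual_simps F ract_elem)
qed

text \<open>The last two formulas add up to the product rule that makes \<open>a \<mapsto> (f \<mapsto> left_limit f a)\<close> a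
  derivation into the dual of the twisted bimodule.\<close>

lemma left_limit_linear:
  assumes f: "f \<in> carrier V"
  shows "left_limit f (a + b) = left_limit f a + left_limit f b"
    and "left_limit f (scaleC c a) = c * left_limit f a"
    and "g \<in> carrier V \<Longrightarrow> left_limit (f \<oplus>\<^bsub>V\<^esub> g) a = left_limit f a + left_limit g a"
    and "left_limit (c \<odot>\<^bsub>V\<^esub> f) a = c * left_limit f a"
    and "left_limit (ract V f b) a = f (elem_tensor b a)"
    and "left_limit (twisted_lact b f) a = left_limit f (a * b) - f (elem_tensor a b)"
proof -
  note lim = left_limit[OF f]
  note F = functionalD[OF f] elem_tensor_props
  show "left_limit f (a + b) = left_limit f a + left_limit f b"
    unfolding left_limit_def[of f "a + b"]
    by (rule tendsto_unique_Lim) (simp add: F tendsto_add lim)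
  show "left_limit f (scaleC c a) = c * left_limit f a"
    unfolding left_limit_def[of f "scaleC c a"]
    by (rule tendsto_unique_Lim) (simp add: F tendsto_mult_left lim)
  show "left_limit (f \<oplus>\<^bsub>V\<^esub> g) a = left_limit f a + left_limit g a" if "g \<in> carrier V"
    unfolding left_limit_def[of "f \<oplus>\<^bsub>V\<^esub> g"]
    by (rule tendsto_unique_Lim) (simp add: dual_simps F tendsto_add lim left_limit[OF that])
  show "left_limit (c \<odot>\<^bsub>V\<^esub> f) a = c * left_limit f a"
    unfolding left_limit_def[of "c \<odot>\<^bsub>V\<^esub> f"]
    by (rule tendsto_unique_Lim) (simp add: dual_simps F tendsto_mult_left lim)
  have "((\<lambda>e. f (elem_tensor (b * e) a)) \<longlongrightarrow> f (elem_tensor b a)) U"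
    by (rule bounded_bilinear.tendsto[OF bounded_bilinear_elem_tensor[OF f] right tendsto_const])
  then show "left_limit (ract V f b) a = f (elem_tensor b a)"
    unfolding left_limit_def by (intro tendsto_unique_Lim) (simp add: dual_simps F lact_elem)
  have "((\<lambda>e. f (elem_tensor (e * a) b)) \<longlongrightarrow> f (elem_tensor a b)) U"
    by (rule bounded_bilinear.tendsto[OF bounded_bilinear_elem_tensor[OF f] left tendsto_const])
  then have "((\<lambda>e. f (elem_tensor e (a * b)) - f (elem_tensor (e * a) b)) \<longlongrightarrow>
      left_limit f (a * b) - f (elem_tensor a b)) U"
    by (intro tendsto_diff lim)
  then show "left_limit (twisted_lact b f) a = left_limit f (a * b) - f (elem_tensor a b)"
    unfolding left_limit_def[of "twisted_lact b f"]
    by (intro tendsto_unique_Lim) (simp add: twisted_lact_def F ract_elem diagonal_op_elem)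
qed

text \<open>The projection of the functionals along those of the form \<open>g \<circ> \<pi>\<close>.  It carries the ordinary
  left action to the twisted one (last item of \<open>reduced_linear\<close>).\<close>

definition reduced :: "('a tensor \<Rightarrow> complex) \<Rightarrow> 'a tensor \<Rightarrow> complex" where
  "reduced f = (\<lambda>x\<in>carrier T. f x - right_limit f (diagonal_op x))"

lemma reduced_le:
  assumes f: "f \<in> carrier V" and x: "x \<in> carrier T"
  shows "cmod (f x - right_limit f (diagonal_op x)) \<le> (1 + K) * vnorm V f * vnorm T x"
proof -
  have "K * vnorm V f * norm (diagonal_op x) \<le> K * vnorm V f * vnorm T x"
    using K_nonneg dual_norm_nonneg[OF normed_space_tensor f] diagonal_op_linear(5)[OF x]
    by (intro mult_left_mono) auto
  then show ?thesis
    using norm_triangle_ineq4[of "f x" "right_limit f (diagonal_op x)"]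
      functional_le[OF normed_space_tensor f x] right_limit_le[OF f, of "diagonal_op x"]
    by (simp add: distrib_right)
qed

lemma reduced_in:
  assumes f: "f \<in> carrier V"
  shows "reduced f \<in> carrier V"
  unfolding reduced_def
  by (rule restrict_functionalI[OF normed_space_tensor _ _ reduced_le[OF f]])
     (simp_all add: functionalD[OF f] diagonal_op_linear right_limit_linear[OF f] algebra_simps)

lemma reduced_norm:
  assumes f: "f \<in> carrier V"
  shows "vnorm V (reduced f) \<le> (1 + K) * vnorm V f"
  using reduced_le[OF f] K_nonneg dual_norm_nonneg[OF normed_space_tensor f]
  by (intro dual_norm_leI[OF normed_space_tensor]) (auto simp: reduced_def)

lemma reduced_linear:
  assumes f: "f \<in> carrier V"
  shows "g \<in> carrier V \<Longrightarrow> reduced (f \<oplus>\<^bsub>V\<^esub> g) = reduced f \<oplus>\<^bsub>V\<^esub> reduced g"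
    and "reduced (c \<odot>\<^bsub>V\<^esub> f) = c \<odot>\<^bsub>V\<^esub> reduced f"
    and "reduced (ract V f b) = ract V (reduced f) b"
    and "reduced (lact V b f) = twisted_lact b (reduced f)"
  using right_limit_linear[OF f, unfolded dual_simps]
  by (auto simp: reduced_def twisted_lact_def dual_simps tensor_act diagonal_op_linear
      diagonal_op_elem elem_tensor_props add_diff_add right_diff_distrib intro!: restrict_ext)

section \<open>Construction of the two maps\<close>

lemma ex_theta:
  fixes \<sigma> :: "'a \<Rightarrow> 'a"
  assumes \<sigma>: "alg_hom \<sigma>" and amenable: "sigma_amenable \<sigma>"
  shows "\<exists>\<theta>. bounded_linear_map (dual proj_tensor) (dual alg_bimodule) \<theta> \<and>
    (\<forall>g\<in>carrier (dual alg_bimodule). \<theta> (dual_map proj_tensor diagonal_op g) = dual_map alg_bimodule \<sigma> g) \<and>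
    (\<forall>a. \<forall>f\<in>carrier (dual proj_tensor).
       \<theta> (lact (dual proj_tensor) (\<sigma> a) f) = lact (dual alg_bimodule) a (\<theta> f) \<and>
       \<theta> (ract (dual proj_tensor) f (\<sigma> a)) = ract (dual alg_bimodule) (\<theta> f) a)"
proof -
  let ?A = "alg_bimodule :: ('a, 'a) bimodule"
  have hom: "\<sigma> (a + b) = \<sigma> a + \<sigma> b" "\<sigma> (scaleC c a) = scaleC c (\<sigma> a)" "\<sigma> (a * b) = \<sigma> a * \<sigma> b" for a b c
    using \<sigma> by (auto simp: alg_hom_def)
  obtain S where S: "S \<ge> 0" "\<And>a. norm (\<sigma> a) \<le> S * norm a"
    using alg_hom_bounded[OF \<sigma>] by blast
  note V = normed_spaceD[OF normed_space_dual[OF normed_space_tensor]]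
  note nonneg = dual_norm_nonneg[OF normed_space_tensor]
  define D where "D a = (\<lambda>f\<in>carrier V. left_limit f (\<sigma> a))" for a
  have D_le: "cmod (left_limit f (\<sigma> a)) \<le> K * S * norm a * vnorm V f" if f: "f \<in> carrier V" for a f
  proof -
    have "K * vnorm V f * norm (\<sigma> a) \<le> K * vnorm V f * (S * norm a)"
      using K_nonneg nonneg[OF f] S(2) by (intro mult_left_mono) auto
    then show ?thesis
      using left_limit_le[OF f, of "\<sigma> a"] by (simp add: mult_ac)
  qed
  have "bounded_linear_map ?A (dual V) D"
    unfolding bounded_linear_map_def
  proof (intro conjI ballI allI exI)
    fix a
    show "D a \<in> carrier (dual V)"
      unfolding D_def
      by (rule restrict_functionalI[OF normed_space_dual[OF normed_space_tensor] _ _ D_le])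
         (simp_all add: left_limit_linear)
    show "vnorm (dual V) (D a) \<le> (K * S) * vnorm ?A a"
      using D_le K_nonneg S(1)
      by (intro dual_norm_leI[OF normed_space_dual[OF normed_space_tensor]])
         (simp_all add: D_def alg_bimodule_simps)
    show "D (c \<odot>\<^bsub>?A\<^esub> a) = c \<odot>\<^bsub>dual V\<^esub> D a" for c
      unfolding D_def dual_simps(3)[of V]
      by (rule restrict_ext) (simp add: alg_bimodule_simps hom left_limit_linear)
    show "D (a \<oplus>\<^bsub>?A\<^esub> b) = D a \<oplus>\<^bsub>dual V\<^esub> D b" for b
      unfolding D_def dual_simps(2)[of V]
      by (rule restrict_ext) (simp add: alg_bimodule_simps hom left_limit_linear)
  qed
  moreover have "D (a * b) f = D b (ract V f (\<sigma> a)) + D a (twisted_lact (\<sigma> b) f)"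
    if "f \<in> carrier V" for a b f
    using that by (simp add: D_def left_limit_linear hom tensor_dual_act_in twisted_lact_in)
  ultimately have "\<exists>N\<in>carrier (dual V). \<forall>a. \<forall>f\<in>carrier V.
      D a f = N (ract V f (\<sigma> a)) - N (twisted_lact (\<sigma> a) f)"
    by (rule sigma_amenable_inner[OF amenable banach_actions_twisted])
  then obtain N where N_in: "N \<in> carrier (dual V)"
    and D_inner: "\<forall>a. \<forall>f\<in>carrier V. D a f = N (ract V f (\<sigma> a)) - N (twisted_lact (\<sigma> a) f)" ..
  have inner: "left_limit f (\<sigma> a) = N (ract V f (\<sigma> a)) - N (twisted_lact (\<sigma> a) f)"
    if f: "f \<in> carrier V" for a f
    using D_inner[THEN spec, THEN bspec, OF f, of a] f by (simp only: D_def restrict_apply' if_True)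
  define B where "B = vnorm (dual V) N"
  have N: "N (f \<oplus>\<^bsub>V\<^esub> g) = N f + N g" "N (c \<odot>\<^bsub>V\<^esub> f) = c * N f" "cmod (N f) \<le> B * vnorm V f" "0 \<le> B"
    if "f \<in> carrier V" "g \<in> carrier V" for f g c
    using functionalD(2,3)[OF N_in] functional_le[OF normed_space_dual[OF normed_space_tensor] N_in]
      dual_norm_nonneg[OF normed_space_dual[OF normed_space_tensor] N_in] that
    by (simp_all add: B_def)
  note N = N(1) N(2)[OF _ V(2)] N(3)[OF _ V(2)] N(4)[OF V(2) V(2)]
  \<comment> \<open>In terms of functionals on the tensor product this is \<open>\<theta> f a = M (f \<cdot> \<sigma> a)\<close> for the virtual
    diagonal \<open>M f = lim\<^sub>e right_limit f e + N (reduced f)\<close>.\<close>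
  define \<theta> where "\<theta> f = (\<lambda>a\<in>carrier ?A. right_limit f (\<sigma> a) + N (ract V (reduced f) (\<sigma> a)))" for f
  interpret tw: banach_actions V twisted_lact "ract V" by (rule banach_actions_twisted)
  have le: "cmod (right_limit f (\<sigma> a) + N (ract V (reduced f) (\<sigma> a))) \<le> (K + B * (1 + K)) * S * vnorm V f * norm a"
    if f: "f \<in> carrier V" for f a
  proof -
    have "cmod (right_limit f (\<sigma> a)) \<le> K * vnorm V f * (S * norm a)"
      using right_limit_le[OF f, of "\<sigma> a"] K_nonneg nonneg[OF f] S(2)[of a]
      by (meson mult_left_mono mult_nonneg_nonneg order_trans)
    moreover have "cmod (N (ract V (reduced f) (\<sigma> a))) \<le> B * ((S * norm a) * ((1 + K) * vnorm V f))"
    proof -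
      have "vnorm V (ract V (reduced f) (\<sigma> a)) \<le> norm (\<sigma> a) * vnorm V (reduced f)"
        by (rule tensor_dual_ract_norm[OF reduced_in[OF f]])
      also have "\<dots> \<le> (S * norm a) * ((1 + K) * vnorm V f)"
        using S(1) nonneg[OF reduced_in[OF f]] by (intro mult_mono S(2) reduced_norm[OF f]) auto
      finally show ?thesis
        using N(3)[OF tw.closed(2)[OF reduced_in[OF f]], of "\<sigma> a"] N(4)
        by (meson mult_left_mono order_trans)
    qed
    ultimately show ?thesis
      using norm_triangle_ineq[of "right_limit f (\<sigma> a)" "N (ract V (reduced f) (\<sigma> a))"]
      by (simp add: algebra_simps)
  qed
  have \<theta>_in: "\<theta> f \<in> carrier (dual ?A)" if f: "f \<in> carrier V" for f
    unfolding \<theta>_def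
  proof (rule restrict_functionalI[OF normed_space_alg])
    fix a show "cmod (right_limit f (\<sigma> a) + N (ract V (reduced f) (\<sigma> a))) \<le> (K + B * (1 + K)) * S * vnorm V f * vnorm ?A a"
      using le[OF f] by (simp add: alg_bimodule_simps)
  qed (simp_all add: alg_bimodule_simps hom right_limit_linear[OF f] tw.act_add(2) tw.act_scaleC(2)
        reduced_in[OF f] tw.closed N algebra_simps)
  have "bounded_linear_map V (dual ?A) \<theta>"
    unfolding bounded_linear_map_def
  proof (intro conjI ballI allI exI)
    fix f assume f: "f \<in> carrier V"
    show "\<theta> f \<in> carrier (dual ?A)" by (rule \<theta>_in[OF f])
    show "vnorm (dual ?A) (\<theta> f) \<le> (K + B * (1 + K)) * S * vnorm V f"
      using le[OF f] K_nonneg N(4) S(1) nonneg[OF f]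
      by (intro dual_norm_leI[OF normed_space_alg]) (simp_all add: \<theta>_def alg_bimodule_simps)
    show "\<theta> (c \<odot>\<^bsub>V\<^esub> f) = c \<odot>\<^bsub>dual ?A\<^esub> \<theta> f" for c
      by (simp add: \<theta>_def dual_simps(3)[of ?A] right_limit_linear[OF f] reduced_linear[OF f] tw.smult tw.closed
          reduced_in[OF f] N distrib_left)
    fix g assume g: "g \<in> carrier V"
    show "\<theta> (f \<oplus>\<^bsub>V\<^esub> g) = \<theta> f \<oplus>\<^bsub>dual ?A\<^esub> \<theta> g"
      by (simp add: \<theta>_def dual_simps(2)[of ?A] right_limit_linear(3)[OF f g] reduced_linear(1)[OF f g] tw.add tw.closed
          reduced_in f g N add_ac)
  qed
  moreover have "\<theta> (dual_map T diagonal_op g) = dual_map ?A \<sigma> g" if g: "g \<in> carrier (dual ?A)" for g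
  proof -
    have G: "bounded_linear g"
    proof (rule bounded_linear_intro)
      show "g (x + y) = g x + g y" "g (t *\<^sub>R x) = t *\<^sub>R g x" "norm (g x) \<le> norm x * vnorm (dual ?A) g" for x y t
        using functionalD(2)[OF g, of x y] functionalD(3)[OF g, of x "of_real t"]
          functional_le[OF normed_space_alg g, of x]
        by (simp_all add: alg_bimodule_simps scaleC_of_real scaleR_conv_of_real mult.commute)
    qed
    have lim: "right_limit (dual_map T diagonal_op g) b = g b" for b
      unfolding right_limit_def
    proof (rule tendsto_unique_Lim)
      show "((\<lambda>e. dual_map T diagonal_op g (elem_tensor b e)) \<longlongrightarrow> g b) U"
        using bounded_linear.tendsto[OF G right]
        by (simp add: dual_map_def elem_tensor_props diagonal_op_elem)
    qed
    have "reduced (dual_map T diagonal_op g) = \<zero>\<^bsub>V\<^esub>"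
      using lim by (auto simp: reduced_def dual_map_def dual_simps intro!: restrict_ext)
    moreover have "ract V \<zero>\<^bsub>V\<^esub> b = \<zero>\<^bsub>V\<^esub>" for b
      by (auto simp: dual_simps tensor_act intro!: restrict_ext)
    moreover have "N \<zero>\<^bsub>V\<^esub> = 0" using N(2)[OF V(2), of 0] normed_spaceD(7)[OF tw.normed V(2)] by simp
    ultimately show ?thesis by (simp add: \<theta>_def lim) (simp add: dual_map_def)
  qed
  moreover have "\<theta> (lact V (\<sigma> a) f) = lact (dual ?A) a (\<theta> f)"
    "\<theta> (ract V f (\<sigma> a)) = ract (dual ?A) (\<theta> f) a" if f: "f \<in> carrier V" for a f
  proof -
    note P = reduced_in[OF f]
    show "\<theta> (ract V f (\<sigma> a)) = ract (dual ?A) (\<theta> f) a"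
      by (simp add: \<theta>_def dual_simps(5)[of ?A] alg_bimodule_simps hom right_limit_linear[OF f]
          reduced_linear[OF f] tw.act_mult(2)[OF P])
    have "N (ract V (twisted_lact (\<sigma> a) (reduced f)) (\<sigma> b)) =
        N (ract V (reduced f) (\<sigma> b * \<sigma> a)) - f (elem_tensor (\<sigma> b) (\<sigma> a)) + right_limit f (\<sigma> b * \<sigma> a)" for b
    proof -
      \<comment> \<open>The formula for \<open>N\<close> at \<open>reduced f \<cdot> \<sigma> b\<close>; its left limit is a value of \<open>reduced f\<close>.\<close>
      have "N (ract V (ract V (reduced f) (\<sigma> b)) (\<sigma> a)) - N (twisted_lact (\<sigma> a) (ract V (reduced f) (\<sigma> b)))
        = left_limit (ract V (reduced f) (\<sigma> b)) (\<sigma> a)"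
        using inner[OF tw.closed(2)[OF P]] by simp
      also have "\<dots> = f (elem_tensor (\<sigma> b) (\<sigma> a)) - right_limit f (\<sigma> b * \<sigma> a)"
        by (simp add: left_limit_linear(5)[OF P]) (simp add: reduced_def elem_tensor_props diagonal_op_elem)
      finally show ?thesis
        by (simp add: tw.act_mult(2)[OF P] tw.act_mult(3)[OF P] algebra_simps)
    qed
    then show "\<theta> (lact V (\<sigma> a) f) = lact (dual ?A) a (\<theta> f)"
      by (simp add: \<theta>_def dual_simps(4)[of ?A] alg_bimodule_simps hom right_limit_linear[OF f]
          reduced_linear[OF f] add.commute)
  qed
  ultimately show ?thesis by blast
qed

end

text \<open>Passing to adjoints turns a map that intertwines the actions of \<open>\<sigma> a\<close> and \<open>a\<close> into one that
  intertwines those of \<open>a\<close> and \<open>\<sigma> a\<close>.\<close>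

lemma sigma_bimodule_hom_dual_map:
  assumes X: "normed_space X" and Y: "normed_space Y"
    and \<theta>: "bounded_linear_map (dual X) (dual Y) \<theta>"
    and act: "\<And>a f. f \<in> carrier (dual X) \<Longrightarrow> \<theta> (lact (dual X) (\<sigma> a) f) = lact (dual Y) a (\<theta> f)"
      "\<And>a f. f \<in> carrier (dual X) \<Longrightarrow> \<theta> (ract (dual X) f (\<sigma> a)) = ract (dual Y) (\<theta> f) a"
    and closed: "\<And>a f. f \<in> carrier (dual X) \<Longrightarrow> lact (dual X) a f \<in> carrier (dual X)"
      "\<And>a f. f \<in> carrier (dual X) \<Longrightarrow> ract (dual X) f a \<in> carrier (dual X)"
  shows "sigma_bimodule_hom \<sigma> (dual (dual Y)) (dual (dual X)) (dual_map (dual X) \<theta>)"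
  unfolding sigma_bimodule_hom_def
proof (intro conjI allI ballI)
  show "bounded_linear_map (dual (dual Y)) (dual (dual X)) (dual_map (dual X) \<theta>)"
    by (rule dual_map_bounded[OF normed_space_dual[OF X] normed_space_dual[OF Y] \<theta>])
  have \<theta>_in: "\<theta> f \<in> carrier (dual Y)" if "f \<in> carrier (dual X)" for f
    using \<theta> that by (auto simp: bounded_linear_map_def)
  fix a \<Phi> assume "\<Phi> \<in> carrier (dual (dual Y))"
  show "dual_map (dual X) \<theta> (lact (dual (dual Y)) a \<Phi>) = lact (dual (dual X)) (\<sigma> a) (dual_map (dual X) \<theta> \<Phi>)"
    unfolding dual_map_def dual_simps(4)[of "dual X"] dual_simps(4)[of "dual Y"]
    by (rule restrict_ext) (simp add: \<theta>_in act closed)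
  show "dual_map (dual X) \<theta> (ract (dual (dual Y)) \<Phi> a) = ract (dual (dual X)) (dual_map (dual X) \<theta> \<Phi>) (\<sigma> a)"
    unfolding dual_map_def dual_simps(5)[of "dual X"] dual_simps(5)[of "dual Y"]
    by (rule restrict_ext) (simp add: \<theta>_in act closed)
qed

theorem proposition4p2:
  fixes \<sigma> :: "'a::complex_banach_algebra \<Rightarrow> 'a"
  assumes "\<exists>F :: 'a filter. bounded_approx_identity F"
    and "alg_hom \<sigma>"
    and "sigma_amenable \<sigma>"
  shows
    "(\<exists>\<theta>. bounded_linear_map (dual proj_tensor) (dual alg_bimodule) \<theta> \<and>
          (\<forall>g\<in>carrier (dual alg_bimodule). \<theta> (dual_map proj_tensor diagonal_op g) = dual_map alg_bimodule \<sigma> g) \<and>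
          (\<forall>a. \<forall>f\<in>carrier (dual proj_tensor).
             \<theta> (lact (dual proj_tensor) (\<sigma> a) f) = lact (dual alg_bimodule) a (\<theta> f) \<and>
             \<theta> (ract (dual proj_tensor) f (\<sigma> a)) = ract (dual alg_bimodule) (\<theta> f) a)) \<and>
     (\<exists>\<gamma>. sigma_bimodule_hom \<sigma> (dual (dual alg_bimodule)) (dual (dual proj_tensor)) \<gamma> \<and>
          (\<forall>\<Phi>\<in>carrier (dual (dual alg_bimodule)).
             dual_map (dual alg_bimodule) (dual_map proj_tensor diagonal_op) (\<gamma> \<Phi>) =
             dual_map (dual alg_bimodule) (dual_map alg_bimodule \<sigma>) \<Phi>))"
proof -
  obtain F :: "'a filter" where F: "bounded_approx_identity F" using assms(1) by blast
  then have "F \<noteq> bot" by (simp add: bounded_approx_identity_def)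
  then obtain U where U: "U \<le> F" "ultrafilter U" using ex_ultrafilter_le by blast
  obtain K where "\<forall>\<^sub>F e in F. norm e \<le> K" using F by (auto simp: bounded_approx_identity_def)
  then interpret approx_identity_ultrafilter U K
    using F U by unfold_locales (auto simp: bounded_approx_identity_def filter_leD intro: tendsto_mono)
  obtain \<theta> where \<theta>: "bounded_linear_map (dual proj_tensor) (dual alg_bimodule) \<theta>"
    "\<And>g. g \<in> carrier (dual alg_bimodule) \<Longrightarrow> \<theta> (dual_map proj_tensor diagonal_op g) = dual_map alg_bimodule \<sigma> g"
    "\<And>a f. f \<in> carrier (dual proj_tensor) \<Longrightarrow> \<theta> (lact (dual proj_tensor) (\<sigma> a) f) = lact (dual alg_bimodule) a (\<theta> f)"
    "\<And>a f. f \<in> carrier (dual proj_tensor) \<Longrightarrow> \<theta> (ract (dual proj_tensor) f (\<sigma> a)) = ract (dual alg_bimodule) (\<theta> f) a"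
    using ex_theta[OF assms(2,3)] by blast
  have "sigma_bimodule_hom \<sigma> (dual (dual alg_bimodule)) (dual (dual proj_tensor)) (dual_map (dual proj_tensor) \<theta>)"
    by (rule sigma_bimodule_hom_dual_map[OF normed_space_tensor normed_space_alg \<theta>(1,3,4) tensor_dual_act_in])
  moreover have "dual_map (dual alg_bimodule) (dual_map proj_tensor diagonal_op) (dual_map (dual proj_tensor) \<theta> \<Phi>) =
      dual_map (dual alg_bimodule) (dual_map alg_bimodule \<sigma>) \<Phi>" for \<Phi> :: "('a \<Rightarrow> complex) \<Rightarrow> complex"
  proof -
    have "bounded_linear_map proj_tensor alg_bimodule (diagonal_op :: 'a tensor \<Rightarrow> 'a)"
      unfolding bounded_linear_map_def
      by (auto simp: alg_bimodule_simps diagonal_op_linear intro!: exI[of _ 1])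
    then have "dual_map proj_tensor diagonal_op g \<in> carrier (dual proj_tensor)"
      if "g \<in> carrier (dual alg_bimodule)" for g :: "'a \<Rightarrow> complex"
      using dual_map_bounded[OF normed_space_tensor normed_space_alg] that
      unfolding bounded_linear_map_def by blast
    then show ?thesis
      unfolding dual_map_def[of "dual alg_bimodule"] dual_map_def[of "dual proj_tensor"]
      by (intro restrict_ext) (simp add: \<theta>(2))
  qed
  ultimately show ?thesis using \<theta> by blast
qed

end
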